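(* Let $g$ be the accelerating Kerr-Newman-(anti-)de Sitter metric with real parameters $a,m,q,\Lambda,\alpha$ (see context). Then the invariant $$Q_2=\frac1{27}\,\frac{I_5I_6-I_7^2}{(I_1^2+I_2^2)^{5/2}}$$ vanishes at the radii of the horizons, i.e. at every point (with $\Omega>0$, $\rho^2\neq0$, $I_1^2+I_2^2\ne0$) whose radial coordinate $r$ is a real root of $$Q(r)=(a^2+q^2-2mr+r^2)(1-\alpha^2r^2)-\tfrac13\Lambda(a^2+r^2)r^2.$$
   Context: Accelerating Kerr-Newman black hole in (anti-)de Sitter spacetime: in coordinates $(t,r,\theta,\phi)$, signature $(-,+,+,+)$, $$ds^2=\frac1{\Omega^2}\Big\{-\frac{Q}{\rho^2}\big[dt-a\sin^2\theta\,d\phi\big]^2+\frac{\rho^2}{Q}dr^2+\frac{\rho^2}{P}d\theta^2+\frac{P}{\rho^2}\sin^2\theta\big[a\,dt-(r^2+a^2)d\phi\big]^2\Big\},$$ $\Omega=1-\alpha r\cos\theta$, $\rho^2=r^2+a^2\cos^2\theta$, $P=1-2\alpha m\cos\theta+(\alpha^2(a^2+q^2)+\frac13\Lambda a^2)\cos^2\theta>0$, $Q=(a^2+q^2-2mr+r^2)(1-\alpha^2r^2)-\frac13\Lambda(a^2+r^2)r^2$. The (event, Cauchy, acceleration, cosmological) horizons are located at the real roots of $Q$. With $C_{\kappa\lambda\mu\nu}$ the Weyl tensor and $C^*_{\kappa\lambda\mu\nu}=\frac12E_{\kappa\lambda\sigma\tau}C^{\sigma\tau}{}_{\mu\nu}$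 its dual ($E$ the Levi-Civita pseudotensor): $I_1=C_{\kappa\lambda\mu\nu}C^{\kappa\lambda\mu\nu}$, $I_2=C^*_{\kappa\lambda\mu\nu}C^{\kappa\lambda\mu\nu}$, $k_\mu=-\nabla_\mu I_1$, $l_\mu=-\nabla_\mu I_2$, $I_5=k_\mu k^\mu$, $I_6=l_\mu l^\mu$, $I_7=k_\mu l^\mu$. All these are functions of $(r,\theta)$ which extend continuously from the regular domain of the metric to points with $Q(r)=0$; the value of $Q_2$ there is the value of this extension. *)

theory Defs
  imports "HOL-Analysis.Analysis"
begin

text \<open>
  A metric is given by its component matrix \<open>g x $ i $ j\<close> at the point with coordinate
  vector \<open>x\<close>. The index position of the components of the tensors below is indicated in the
  comments; all contractions are written out with the inverse metric \<open>ginv\<close>.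
\<close>

type_synonym 'n metric = "real^'n \<Rightarrow> real^'n^'n"
type_synonym 'n tensor4 = "'n \<Rightarrow> 'n \<Rightarrow> 'n \<Rightarrow> 'n \<Rightarrow> real^'n \<Rightarrow> real"

definition pd :: "'n::finite \<Rightarrow> (real^'n \<Rightarrow> real) \<Rightarrow> real^'n \<Rightarrow> real" where
  "pd i f x = deriv (\<lambda>h. f (x + h *\<^sub>R axis i 1)) 0"

definition ginv :: "'n::finite metric \<Rightarrow> 'n metric" where
  "ginv g x = matrix_inv (g x)"

(* Gamma^i_{jk} *)
definition christoffel :: "'n::finite metric \<Rightarrow> 'n \<Rightarrow> 'n \<Rightarrow> 'n \<Rightarrow> real^'n \<Rightarrow> real" where
  "christoffel g i j k x = 1/2 * (\<Sum>l\<in>UNIV. ginv g x $ i $ l *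
     (pd j (\<lambda>y. g y $ l $ k) x + pd k (\<lambda>y. g y $ l $ j) x - pd l (\<lambda>y. g y $ j $ k) x))"

(* R^i_{jkl} *)
definition riemann_up :: "'n::finite metric \<Rightarrow> 'n tensor4" where
  "riemann_up g i j k l x =
     pd k (christoffel g i l j) x - pd l (christoffel g i k j) x
     + (\<Sum>s\<in>UNIV. christoffel g i k s x * christoffel g s l j x
                 - christoffel g i l s x * christoffel g s k j x)"

(* R_{ijkl} *)
definition riemann :: "'n::finite metric \<Rightarrow> 'n tensor4" where
  "riemann g i j k l x = (\<Sum>s\<in>UNIV. g x $ i $ s * riemann_up g s j k l x)"

(* R_{jl} = R^i_{jil} *)
definition ricci :: "'n::finite metric \<Rightarrow> 'n \<Rightarrow> 'n \<Rightarrow> real^'n \<Rightarrow> real" where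
  "ricci g j l x = (\<Sum>i\<in>UNIV. riemann_up g i j i l x)"

definition scalar_curvature :: "'n::finite metric \<Rightarrow> real^'n \<Rightarrow> real" where
  "scalar_curvature g x = (\<Sum>i\<in>UNIV. \<Sum>j\<in>UNIV. ginv g x $ i $ j * ricci g i j x)"

(* C_{ijkl} *)
definition weyl :: "'n::finite metric \<Rightarrow> 'n tensor4" where
  "weyl g i j k l x = riemann g i j k l x
     - 1 / (real CARD('n) - 2) *
         (g x $ i $ k * ricci g j l x - g x $ i $ l * ricci g j k x
        - g x $ j $ k * ricci g i l x + g x $ j $ l * ricci g i k x)
     + scalar_curvature g x / ((real CARD('n) - 1) * (real CARD('n) - 2)) *
         (g x $ i $ k * g x $ j $ l - g x $ i $ l * g x $ j $ k)"

(* T^{ij}_{kl} from T_{ijkl} *)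
definition raise12 :: "'n::finite metric \<Rightarrow> 'n tensor4 \<Rightarrow> 'n tensor4" where
  "raise12 g T i j k l x =
     (\<Sum>s\<in>UNIV. \<Sum>t\<in>UNIV. ginv g x $ i $ s * ginv g x $ j $ t * T s t k l x)"

(* T^{ijkl} from T_{ijkl} *)
definition raise_all :: "'n::finite metric \<Rightarrow> 'n tensor4 \<Rightarrow> 'n tensor4" where
  "raise_all g T i j k l x =
     (\<Sum>s\<in>UNIV. \<Sum>t\<in>UNIV. \<Sum>u\<in>UNIV. \<Sum>v\<in>UNIV.
        ginv g x $ i $ s * ginv g x $ j $ t * ginv g x $ k $ u * ginv g x $ l $ v * T s t u v x)"

text \<open>
  The Levi-Civita pseudotensor is \<open>E\<^sub>i\<^sub>j\<^sub>k\<^sub>l = sqrt \<bar>det g\<bar> \<epsilon>\<^sub>i\<^sub>j\<^sub>k\<^sub>l\<close> with \<open>\<epsilon>\<^sub>1\<^sub>2\<^sub>3\<^sub>4 = 1\<close>. The opposite orientation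
  changes the sign of the dual Weyl tensor, hence of \<open>I2\<close> and \<open>I7\<close>, and leaves \<open>Q2\<close> unchanged.
\<close>

definition levi_civita_symbol :: "4 \<Rightarrow> 4 \<Rightarrow> 4 \<Rightarrow> 4 \<Rightarrow> real" where
  "levi_civita_symbol i j k l =
     det (vector [axis i 1, axis j 1, axis k 1, axis l 1] :: real^4^4)"

definition levi_civita :: "4 metric \<Rightarrow> 4 tensor4" where
  "levi_civita g i j k l x = sqrt \<bar>det (g x)\<bar> * levi_civita_symbol i j k l"

definition dual_weyl :: "4 metric \<Rightarrow> 4 tensor4" where
  "dual_weyl g i j k l x =
     1/2 * (\<Sum>s\<in>UNIV. \<Sum>t\<in>UNIV. levi_civita g i j s t x * raise12 g (weyl g) s t k l x)"

definition I1 :: "4 metric \<Rightarrow> real^4 \<Rightarrow> real" where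
  "I1 g x = (\<Sum>i\<in>UNIV. \<Sum>j\<in>UNIV. \<Sum>k\<in>UNIV. \<Sum>l\<in>UNIV.
     weyl g i j k l x * raise_all g (weyl g) i j k l x)"

definition I2 :: "4 metric \<Rightarrow> real^4 \<Rightarrow> real" where
  "I2 g x = (\<Sum>i\<in>UNIV. \<Sum>j\<in>UNIV. \<Sum>k\<in>UNIV. \<Sum>l\<in>UNIV.
     dual_weyl g i j k l x * raise_all g (weyl g) i j k l x)"

(* The covariant derivative of a scalar is its partial derivative. *)
definition k_cov :: "4 metric \<Rightarrow> 4 \<Rightarrow> real^4 \<Rightarrow> real" where
  "k_cov g i x = - pd i (I1 g) x"

definition l_cov :: "4 metric \<Rightarrow> 4 \<Rightarrow> real^4 \<Rightarrow> real" where
  "l_cov g i x = - pd i (I2 g) x"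

definition cov_inner :: "4 metric \<Rightarrow> (4 \<Rightarrow> real^4 \<Rightarrow> real) \<Rightarrow> (4 \<Rightarrow> real^4 \<Rightarrow> real) \<Rightarrow> real^4 \<Rightarrow> real" where
  "cov_inner g v w x = (\<Sum>i\<in>UNIV. \<Sum>j\<in>UNIV. ginv g x $ i $ j * v i x * w j x)"

definition I5 :: "4 metric \<Rightarrow> real^4 \<Rightarrow> real" where
  "I5 g = cov_inner g (k_cov g) (k_cov g)"

definition I6 :: "4 metric \<Rightarrow> real^4 \<Rightarrow> real" where
  "I6 g = cov_inner g (l_cov g) (l_cov g)"

definition I7 :: "4 metric \<Rightarrow> real^4 \<Rightarrow> real" where
  "I7 g = cov_inner g (k_cov g) (l_cov g)"

definition Q2 :: "4 metric \<Rightarrow> real^4 \<Rightarrow> real" where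
  "Q2 g x = 1/27 * ((I5 g x * I6 g x - (I7 g x)\<^sup>2) / ((I1 g x)\<^sup>2 + (I2 g x)\<^sup>2) powr (5/2))"

text \<open>The components \<open>1, 2, 3, 4\<close> of a point are the coordinates \<open>t, r, \<theta>, \<phi>\<close>.\<close>

definition bh_Omega :: "real \<Rightarrow> real \<Rightarrow> real \<Rightarrow> real" where
  "bh_Omega \<alpha> r \<theta> = 1 - \<alpha> * r * cos \<theta>"

definition bh_rho2 :: "real \<Rightarrow> real \<Rightarrow> real \<Rightarrow> real" where
  "bh_rho2 a r \<theta> = r\<^sup>2 + a\<^sup>2 * (cos \<theta>)\<^sup>2"

definition bh_P :: "real \<Rightarrow> real \<Rightarrow> real \<Rightarrow> real \<Rightarrow> real \<Rightarrow> real \<Rightarrow> real" where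
  "bh_P a m q \<Lambda> \<alpha> \<theta> =
     1 - 2 * \<alpha> * m * cos \<theta> + (\<alpha>\<^sup>2 * (a\<^sup>2 + q\<^sup>2) + 1/3 * \<Lambda> * a\<^sup>2) * (cos \<theta>)\<^sup>2"

definition bh_Q :: "real \<Rightarrow> real \<Rightarrow> real \<Rightarrow> real \<Rightarrow> real \<Rightarrow> real \<Rightarrow> real" where
  "bh_Q a m q \<Lambda> \<alpha> r =
     (a\<^sup>2 + q\<^sup>2 - 2 * m * r + r\<^sup>2) * (1 - \<alpha>\<^sup>2 * r\<^sup>2) - 1/3 * \<Lambda> * (a\<^sup>2 + r\<^sup>2) * r\<^sup>2"

definition bh_metric :: "real \<Rightarrow> real \<Rightarrow> real \<Rightarrow> real \<Rightarrow> real \<Rightarrow> 4 metric" where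
  "bh_metric a m q \<Lambda> \<alpha> x =
     (let r = x $ 2; \<theta> = x $ 3;
          \<Omega> = bh_Omega \<alpha> r \<theta>; \<rho>2 = bh_rho2 a r \<theta>;
          P = bh_P a m q \<Lambda> \<alpha> \<theta>; Q = bh_Q a m q \<Lambda> \<alpha> r;
          dt = axis 1 1; dr = axis 2 1; d\<theta> = axis 3 1; d\<phi> = axis 4 1;
          u = dt - (a * (sin \<theta>)\<^sup>2) *\<^sub>R d\<phi>;
          v = a *\<^sub>R dt - (r\<^sup>2 + a\<^sup>2) *\<^sub>R d\<phi>
      in \<chi> i j. 1 / \<Omega>\<^sup>2 *
           (- (Q / \<rho>2) * (u $ i * u $ j)
            + \<rho>2 / Q * (dr $ i * dr $ j)
            + \<rho>2 / P * (d\<theta> $ i * d\<theta> $ j)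
            + P / \<rho>2 * (sin \<theta>)\<^sup>2 * (v $ i * v $ j)))"

definition bh_regular :: "real \<Rightarrow> real \<Rightarrow> real \<Rightarrow> real \<Rightarrow> real \<Rightarrow> (real^4) set" where
  "bh_regular a m q \<Lambda> \<alpha> =
     {x. 0 < x $ 3 \<and> x $ 3 < pi \<and> bh_Omega \<alpha> (x $ 2) (x $ 3) > 0 \<and> bh_rho2 a (x $ 2) (x $ 3) \<noteq> 0
       \<and> bh_P a m q \<Lambda> \<alpha> (x $ 3) > 0 \<and> bh_Q a m q \<Lambda> \<alpha> (x $ 2) \<noteq> 0}"

definition extends_continuously :: "('a::topological_space \<Rightarrow> real) \<Rightarrow> 'a set \<Rightarrow> 'a \<Rightarrow> bool" where
  "extends_continuously f D p \<longleftrightarrow> p islimpt D \<and> (\<exists>L. (f \<longlongrightarrow> L) (at p within D))"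

(* Lim is an unspecified value unless extends_continuously f D p holds. *)
definition ext_value :: "('a::topological_space \<Rightarrow> real) \<Rightarrow> 'a set \<Rightarrow> 'a \<Rightarrow> real" where
  "ext_value f D p = Lim (at p within D) f"

end

theory Submission
  imports Defs "HOL-Complex_Analysis.Cauchy_Integral_Formula"
begin

text \<open>
  Only \<open>r\<close> and \<open>\<theta>\<close> enter the invariants, so \<open>I\<^sub>5 I\<^sub>6 - I\<^sub>7\<^sup>2 = g\<^sup>r\<^sup>r g\<^sup>\<theta>\<^sup>\<theta> (\<partial>\<^sub>r I\<^sub>1 \<partial>\<^sub>\<theta> I\<^sub>2 - \<partial>\<^sub>\<theta> I\<^sub>1 \<partial>\<^sub>r I\<^sub>2)\<^sup>2\<close>,
  and \<open>g\<^sup>r\<^sup>r = \<Omega>\<^sup>2 Q / \<rho>\<^sup>2\<close> tends to zero at a root of \<open>Q\<close>. What remains is that \<open>I\<^sub>1\<close>, \<open>I\<^sub>2\<close> and their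
  first derivatives stay bounded there, including on the axis \<open>sin \<theta> = 0\<close>. No curvature is computed for
  this: passing to Eddington--Finkelstein coordinates in the \<open>r\<close>-direction, and to their complex analogue
  in the \<open>cos \<theta>\<close>-direction, the metric and its inverse become polynomial in \<open>r\<close>, \<open>cos \<theta>\<close>, \<open>1/\<rho>\<^sup>2\<close>, \<open>1/\<Omega>\<close>.
  The ring of such functions is closed under differentiation, so by covariance it contains \<open>I\<^sub>1\<close> and \<open>I\<^sub>2\<close>.
\<close>

subsection \<open>Complex-valued partial derivatives\<close>

text \<open>In the given coordinates \<open>g_rr\<close> is infinite at a horizon and the
  determinant of the metric vanishes on the axis, so the size of curvature components there says
  nothing about the invariants. The cure is to complete squares. With u and v the real forms of the
  metric, U = u + (\<rho>^2/Q) dr gives - (Q/\<rho>^2) u^2 + (\<rho>^2/Q) dr^2 = - (Q/\<rho>^2) U^2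
  + 2 U dr. In the other block both squares have the same sign, so the analogous shift V = v - i
  \<rho>^2/(P sin \<theta>) d\<theta> has to be imaginary; this is the only reason for complex
  numbers.

  Afterwards all poles sit in the coframe. A scalar contraction pairs every coframe matrix with its
  inverse, which removes them. Derivatives of the coframe could still obstruct, but they cancel from
  the curvature because the coframe is closed; closedness is all that is used, and no complex
  coordinates are ever constructed. The orientation is the one exception to the pairing: the dual
  Weyl tensor leaves a determinant factor, whose regularity is checked by hand.\<close>

definition has_pd :: "'n::finite \<Rightarrow> (real^'n \<Rightarrow> complex) \<Rightarrow> complex \<Rightarrow> real^'n \<Rightarrow> bool" where
  "has_pd i f d x \<longleftrightarrow> ((\<lambda>h. f (x + h *\<^sub>R axis i 1)) has_vector_derivative d) (at 0)"

lemma has_pd_const: "has_pd i (\<lambda>_. c) 0 x"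
  unfolding has_pd_def by simp

lemma has_pd_add:
  assumes "has_pd i f d x" "has_pd i f' d' x"
  shows "has_pd i (\<lambda>y. f y + f' y) (d + d') x"
  using assms unfolding has_pd_def by (rule has_vector_derivative_add)

lemma has_pd_mult:
  assumes "has_pd i f d x" "has_pd i f' d' x"
  shows "has_pd i (\<lambda>y. f y * f' y) (d * f' x + f x * d') x"
  using has_vector_derivative_mult[OF assms[unfolded has_pd_def]]
  unfolding has_pd_def by (simp add: add.commute)

lemma has_pd_sum:
  assumes "\<And>s. s \<in> S \<Longrightarrow> has_pd i (f s) (d s) x"
  shows "has_pd i (\<lambda>y. \<Sum>s\<in>S. f s y) (\<Sum>s\<in>S. d s) x"
  using assms unfolding has_pd_def by (intro has_vector_derivative_sum) auto

lemma has_pd_unique: "has_pd i f d x \<Longrightarrow> has_pd i f d' x \<Longrightarrow> d = d'"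
  unfolding has_pd_def by (rule vector_derivative_unique_at)

lemma eventually_line_in_open:
  fixes x :: "real^'n::finite"
  assumes "open D" "x \<in> D"
  shows "eventually (\<lambda>h. x + h *\<^sub>R axis i 1 \<in> D) (nhds (0::real))"
proof -
  have "((\<lambda>h::real. x + h *\<^sub>R axis i 1) \<longlongrightarrow> x + 0 *\<^sub>R axis i 1) (nhds 0)"
    by (intro tendsto_intros filterlim_ident)
  then show ?thesis
    using assms topological_tendstoD by fastforce
qed

lemma has_pd_cong:
  assumes "open D" "x \<in> D" "\<And>y. y \<in> D \<Longrightarrow> f y = f' y"
  shows "has_pd i f d x \<longleftrightarrow> has_pd i f' d x"
proof -
  have "eventually (\<lambda>h. f (x + h *\<^sub>R axis i 1) = f' (x + h *\<^sub>R axis i 1)) (nhds (0::real))"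
    by (rule eventually_mono[OF eventually_line_in_open[OF assms(1,2)]]) (rule assms(3))
  then have "eventually (\<lambda>h. h \<in> UNIV \<longrightarrow> f (x + h *\<^sub>R axis i 1) = f' (x + h *\<^sub>R axis i 1)) (nhds (0::real))"
    by (rule eventually_mono) simp
  then show ?thesis
    unfolding has_pd_def
    by (intro has_vector_derivative_cong_ev) (use assms in auto)
qed

text \<open>Difference quotients of a real function are real, so the imaginary part of the
  derivative of \<open>F\<close> vanishes. Through this lemma complex calculations reach
  \<open>pd\<close>: the differentiability that \<open>deriv\<close> needs is supplied by
  \<open>F\<close>.\<close>

lemma of_real_pd:
  assumes D: "open D" "x \<in> D" and eq: "\<And>y. y \<in> D \<Longrightarrow> of_real (f y) = F y"
    and F: "has_pd i F d x"
  shows "of_real (pd i f x) = d"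
proof -
  have 1: "((\<lambda>h. complex_of_real (f (x + h *\<^sub>R axis i 1))) has_vector_derivative d) (at 0)"
    using F has_pd_cong[OF D, of "\<lambda>y. of_real (f y)" F i d] eq
    unfolding has_pd_def by simp
  have 2: "((\<lambda>h. f (x + h *\<^sub>R axis i 1)) has_vector_derivative Re d) (at 0)"
    using bounded_linear.has_vector_derivative[OF bounded_linear_Re 1] by simp
  have 3: "((\<lambda>h. 0) has_vector_derivative Im d) (at (0::real))"
    using bounded_linear.has_vector_derivative[OF bounded_linear_Im 1] by simp
  have "Im d = 0"
    using vector_derivative_unique_at[OF 3 has_vector_derivative_const] .
  moreover have "pd i f x = Re d"
    unfolding pd_def
    by (rule DERIV_imp_deriv) (use 2 in \<open>simp add: has_real_derivative_iff_has_vector_derivative\<close>)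
  ultimately show ?thesis
    by (simp add: complex_eq_iff)
qed

lemma has_pd_of_real_component:
  assumes "F analytic_on {of_real (x $ i)}"
  shows "has_pd j (\<lambda>y. F (of_real (y $ i))) (if j = i then deriv F (of_real (x $ i)) else 0) x"
proof (cases "j = i")
  case True
  have "((\<lambda>h. complex_of_real (x $ i + h)) has_vector_derivative 1) (at 0)"
  proof -
    have "((\<lambda>h. x $ i + h) has_vector_derivative 1) (at 0)"
      unfolding has_real_derivative_iff_has_vector_derivative[symmetric]
      by (rule DERIV_cong[OF DERIV_add[OF DERIV_const DERIV_ident]]) simp
    from bounded_linear.has_vector_derivative[OF bounded_linear_of_real this] show ?thesis
      by simp
  qed
  moreover have "(F has_field_derivative deriv F (of_real (x $ i + 0))) (at (of_real (x $ i + 0)))"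
    using assms analytic_on_imp_differentiable_at field_differentiable_derivI by force
  ultimately have "(F \<circ> (\<lambda>h. complex_of_real (x $ i + h)) has_vector_derivative
      1 * deriv F (of_real (x $ i + 0))) (at 0)"
    by (rule field_vector_diff_chain_at)
  then show ?thesis
    using True by (simp add: has_pd_def o_def axis_def)
next
  case False
  then show ?thesis by (simp add: has_pd_def axis_def)
qed

section \<open>Matrices acting on single indices of four-index tensors\<close>

type_synonym 'n ctensor4 = "'n \<Rightarrow> 'n \<Rightarrow> 'n \<Rightarrow> 'n \<Rightarrow> complex"

definition slot1 :: "complex^'n^'n \<Rightarrow> 'n::finite ctensor4 \<Rightarrow> 'n ctensor4" where
  "slot1 A T i j k l = (\<Sum>s\<in>UNIV. A $ i $ s * T s j k l)"
definition slot2 :: "complex^'n^'n \<Rightarrow> 'n::finite ctensor4 \<Rightarrow> 'n ctensor4" where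
  "slot2 A T i j k l = (\<Sum>s\<in>UNIV. A $ j $ s * T i s k l)"
definition slot3 :: "complex^'n^'n \<Rightarrow> 'n::finite ctensor4 \<Rightarrow> 'n ctensor4" where
  "slot3 A T i j k l = (\<Sum>s\<in>UNIV. A $ k $ s * T i j s l)"
definition slot4 :: "complex^'n^'n \<Rightarrow> 'n::finite ctensor4 \<Rightarrow> 'n ctensor4" where
  "slot4 A T i j k l = (\<Sum>s\<in>UNIV. A $ l $ s * T i j k s)"

lemmas slot_defs = slot1_def slot2_def slot3_def slot4_def

lemma slot_mult:
  "slot1 A (slot1 B T) = slot1 (A ** B) T"
  "slot2 A (slot2 B T) = slot2 (A ** B) T"
  "slot3 A (slot3 B T) = slot3 (A ** B) T"
  "slot4 A (slot4 B T) = slot4 (A ** B) T"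
  unfolding slot_defs matrix_matrix_mult_def fun_eq_iff vec_lambda_beta
    sum_distrib_left sum_distrib_right mult.assoc
  by (intro conjI allI; rule sum.swap)+

lemma slot_commute:
  "slot2 A (slot1 B T) = slot1 B (slot2 A T)"
  "slot3 A (slot1 B T) = slot1 B (slot3 A T)"
  "slot4 A (slot1 B T) = slot1 B (slot4 A T)"
  "slot3 A (slot2 B T) = slot2 B (slot3 A T)"
  "slot4 A (slot2 B T) = slot2 B (slot4 A T)"
  "slot4 A (slot3 B T) = slot3 B (slot4 A T)"
  unfolding slot_defs fun_eq_iff sum_distrib_left mult.left_commute[of "A $ _ $ _"]
  by (intro conjI allI; rule sum.swap)+

definition tensor_inner :: "'n::finite ctensor4 \<Rightarrow> 'n ctensor4 \<Rightarrow> complex" where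
  "tensor_inner S T = (\<Sum>i\<in>UNIV. \<Sum>j\<in>UNIV. \<Sum>k\<in>UNIV. \<Sum>l\<in>UNIV. S i j k l * T i j k l)"

lemma sum_adjoint:
  fixes f g :: "'n::finite \<Rightarrow> complex"
  shows "(\<Sum>i\<in>UNIV. (\<Sum>s\<in>UNIV. A i s * f s) * g i) = (\<Sum>i\<in>UNIV. f i * (\<Sum>s\<in>UNIV. A s i * g s))"
  unfolding sum_distrib_left sum_distrib_right
  by (subst sum.swap) (simp add: mult_ac)

text \<open>In full contractions this brings a coframe matrix acting on one factor next to its
  inverse acting on the other.\<close>

lemma tensor_inner_slot:
  "tensor_inner (slot1 A S) T = tensor_inner S (slot1 (transpose A) T)"
  "tensor_inner (slot2 A S) T = tensor_inner S (slot2 (transpose A) T)"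
  "tensor_inner (slot3 A S) T = tensor_inner S (slot3 (transpose A) T)"
  "tensor_inner (slot4 A S) T = tensor_inner S (slot4 (transpose A) T)"
proof -
  \<comment> \<open>The index acted on is moved to the innermost sum, where
    \<open>sum_adjoint\<close> applies.\<close>
  have perm: "(\<Sum>i\<in>UNIV. \<Sum>j\<in>UNIV. \<Sum>k\<in>UNIV. \<Sum>l\<in>UNIV. f i j k l) =
     (\<Sum>j\<in>UNIV. \<Sum>k\<in>UNIV. \<Sum>l\<in>UNIV. \<Sum>i\<in>UNIV. f i j k l)" for f :: "'n ctensor4"
    by (subst sum.swap, rule sum.cong, rule refl, subst sum.swap, rule sum.cong, rule refl, rule sum.swap)
  have perm2: "(\<Sum>i\<in>UNIV. \<Sum>j\<in>UNIV. \<Sum>k\<in>UNIV. \<Sum>l\<in>UNIV. f i j k l) =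
     (\<Sum>i\<in>UNIV. \<Sum>k\<in>UNIV. \<Sum>l\<in>UNIV. \<Sum>j\<in>UNIV. f i j k l)" for f :: "'n ctensor4"
    by (rule sum.cong, rule refl, subst sum.swap, rule sum.cong, rule refl, rule sum.swap)
  have perm3: "(\<Sum>i\<in>UNIV. \<Sum>j\<in>UNIV. \<Sum>k\<in>UNIV. \<Sum>l\<in>UNIV. f i j k l) =
     (\<Sum>i\<in>UNIV. \<Sum>j\<in>UNIV. \<Sum>l\<in>UNIV. \<Sum>k\<in>UNIV. f i j k l)" for f :: "'n ctensor4"
    by (rule sum.cong, rule refl, rule sum.cong, rule refl, rule sum.swap)
  show "tensor_inner (slot1 A S) T = tensor_inner S (slot1 (transpose A) T)"
    unfolding tensor_inner_def slot_defs transpose_def vec_lambda_beta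
    by (rule box_equals[OF _ perm[symmetric] perm[symmetric]]) (subst sum_adjoint, rule refl)
  show "tensor_inner (slot2 A S) T = tensor_inner S (slot2 (transpose A) T)"
    unfolding tensor_inner_def slot_defs transpose_def vec_lambda_beta
    by (rule box_equals[OF _ perm2[symmetric] perm2[symmetric]]) (subst sum_adjoint, rule refl)
  show "tensor_inner (slot3 A S) T = tensor_inner S (slot3 (transpose A) T)"
    unfolding tensor_inner_def slot_defs transpose_def vec_lambda_beta
    by (rule box_equals[OF _ perm3[symmetric] perm3[symmetric]]) (subst sum_adjoint, rule refl)
  show "tensor_inner (slot4 A S) T = tensor_inner S (slot4 (transpose A) T)"
    unfolding tensor_inner_def slot_defs transpose_def vec_lambda_beta
    by (subst sum_adjoint) (rule refl)
qed

subsection \<open>Covariance of curvature under a closed complex coframe\<close>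

lemma sum_swap3:
  "(\<Sum>a\<in>A. \<Sum>b\<in>B. \<Sum>c\<in>C. f a b c) = (\<Sum>c\<in>C. \<Sum>a\<in>A. \<Sum>b\<in>B. f a b c)"
proof -
  have "(\<Sum>a\<in>A. \<Sum>b\<in>B. \<Sum>c\<in>C. f a b c) = (\<Sum>a\<in>A. \<Sum>c\<in>C. \<Sum>b\<in>B. f a b c)"
    by (rule sum.cong[OF refl]) (rule sum.swap)
  then show ?thesis by (simp only: sum.swap[of _ C A])
qed

text \<open>
  In the next two lemmas \<open>\<Theta> a i\<close> stands for the coframe, \<open>\<Theta>' a i j\<close> for its derivatives, which are symmetric because
  the coframe is closed, \<open>h\<close> for the metric in the coframe and \<open>h' c a b\<close> for its frame derivatives.
\<close>

lemma koszul_pullback: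
  fixes \<Theta> :: "'n::finite \<Rightarrow> 'n \<Rightarrow> complex" and \<Theta>' h' :: "'n \<Rightarrow> 'n \<Rightarrow> 'n \<Rightarrow> complex"
  assumes sym: "\<And>a b. h a b = h b a" "\<And>a i j. \<Theta>' a i j = \<Theta>' a j i"
  defines "dg \<equiv> \<lambda>j l k. \<Sum>a\<in>UNIV. \<Sum>b\<in>UNIV. (\<Theta>' a j l * \<Theta> b k + \<Theta> a l * \<Theta>' b j k) * h a b
             + \<Theta> a l * \<Theta> b k * (\<Sum>c\<in>UNIV. \<Theta> c j * h' c a b)"
  shows "dg j l k + dg k l j - dg l j k = (\<Sum>a\<in>UNIV. \<Theta> a l *
      ((\<Sum>b\<in>UNIV. \<Sum>c\<in>UNIV. \<Theta> b j * \<Theta> c k * (h' b a c + h' c a b - h' a b c))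
        + 2 * (\<Sum>b\<in>UNIV. h a b * \<Theta>' b j k)))"
proof -
  define S where "S j l k = (\<Sum>a\<in>UNIV. \<Sum>b\<in>UNIV. \<Theta>' a j l * \<Theta> b k * h a b)" for j l k
  define T where "T j l k = (\<Sum>a\<in>UNIV. \<Sum>b\<in>UNIV. \<Sum>c\<in>UNIV. \<Theta> a l * \<Theta> b k * \<Theta> c j * h' c a b)" for j l k
  have S2: "(\<Sum>a\<in>UNIV. \<Sum>b\<in>UNIV. \<Theta> a l * \<Theta>' b j k * h a b) = S j k l" for j k l
    unfolding S_def by (rule trans[OF sum.swap], intro sum.cong refl, subst sym(1)) (simp add: mult_ac)
  have S_sym: "S j l k = S l j k" for j l k
    unfolding S_def by (simp add: sym(2)[of _ j l])
  have dg: "dg j l k = S j l k + S j k l + T j l k" for j l k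
  proof -
    have "dg j l k = S j l k + (\<Sum>a\<in>UNIV. \<Sum>b\<in>UNIV. \<Theta> a l * \<Theta>' b j k * h a b) + T j l k"
      unfolding dg_def S_def T_def
      by (simp add: sum.distrib algebra_simps sum_distrib_left sum_distrib_right)
    then show ?thesis unfolding S2 .
  qed
  have T1: "T j l k = (\<Sum>a\<in>UNIV. \<Theta> a l * (\<Sum>b\<in>UNIV. \<Sum>c\<in>UNIV. \<Theta> b j * \<Theta> c k * h' b a c))"
    unfolding T_def sum_distrib_left
    by (rule sum.cong[OF refl], subst sum.swap) (simp add: mult_ac)
  have T2: "T k l j = (\<Sum>a\<in>UNIV. \<Theta> a l * (\<Sum>b\<in>UNIV. \<Sum>c\<in>UNIV. \<Theta> b j * \<Theta> c k * h' c a b))"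
    unfolding T_def sum_distrib_left by (simp add: mult_ac)
  have T3: "T l j k = (\<Sum>a\<in>UNIV. \<Theta> a l * (\<Sum>b\<in>UNIV. \<Sum>c\<in>UNIV. \<Theta> b j * \<Theta> c k * h' a b c))"
    unfolding T_def sum_distrib_left by (subst sum_swap3) (simp add: mult_ac)
  have S3: "2 * S j k l = (\<Sum>a\<in>UNIV. \<Theta> a l * (2 * (\<Sum>b\<in>UNIV. h a b * \<Theta>' b j k)))"
  proof -
    have "(\<Sum>a\<in>UNIV. \<Theta> a l * (2 * (\<Sum>b\<in>UNIV. h a b * \<Theta>' b j k))) =
        2 * (\<Sum>a\<in>UNIV. \<Sum>b\<in>UNIV. \<Theta> a l * \<Theta>' b j k * h a b)"
      unfolding sum_distrib_left by (simp add: mult_ac)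
    then show ?thesis unfolding S2 by simp
  qed
  \<comment> \<open>Of the six terms containing \<open>\<Theta>'\<close>, four cancel in pairs by
    the symmetry of \<open>S\<close> in its first two arguments. The remaining two agree and form
    the inhomogeneous part of the transformation law of a connection.\<close>
  have "dg j l k + dg k l j - dg l j k = 2 * S j k l + T j l k + T k l j - T l j k"
    unfolding dg S_sym[of k j l] S_sym[of k l j] S_sym[of l j k] by simp
  then show ?thesis
    unfolding T1 T2 T3 S3
    by (simp add: sum.distrib sum_subtractf algebra_simps)
qed

lemma curvature_pullback:
  fixes \<Theta> :: "'n::finite \<Rightarrow> 'n \<Rightarrow> complex" and \<Theta>' G :: "'n \<Rightarrow> 'n \<Rightarrow> 'n \<Rightarrow> complex"
    and C :: "'n \<Rightarrow> 'n \<Rightarrow> 'n \<Rightarrow> complex" and C' G' :: "'n \<Rightarrow> 'n \<Rightarrow> 'n \<Rightarrow> 'n \<Rightarrow> complex"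
  assumes \<Theta>'_sym: "\<And>a i j. \<Theta>' a i j = \<Theta>' a j i"
    and \<Theta>''_sym: "\<Theta>'' k l j = \<Theta>'' l k j"
    and AA: "\<And>a l j. (\<Sum>i\<in>UNIV. \<Theta> a i * C i l j) =
       (\<Sum>b\<in>UNIV. \<Sum>c\<in>UNIV. \<Theta> b l * \<Theta> c j * G a b c) + \<Theta>' a l j"
    and dA: "\<And>k l j. (\<Sum>i\<in>UNIV. \<Theta>' a k i * C i l j + \<Theta> a i * C' k i l j) =
       (\<Sum>b\<in>UNIV. \<Sum>c\<in>UNIV. (\<Theta>' b k l * \<Theta> c j + \<Theta> b l * \<Theta>' c k j) * G a b c
          + \<Theta> b l * \<Theta> c j * (\<Sum>d\<in>UNIV. \<Theta> d k * G' d a b c)) + \<Theta>'' k l j"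
  shows "(\<Sum>i\<in>UNIV. \<Theta> a i * (C' k i l j - C' l i k j + (\<Sum>s\<in>UNIV. C i k s * C s l j - C i l s * C s k j))) =
     (\<Sum>b\<in>UNIV. \<Theta> b j * (\<Sum>c\<in>UNIV. \<Theta> c k * (\<Sum>d\<in>UNIV. \<Theta> d l *
        (G' c a d b - G' d a c b + (\<Sum>f\<in>UNIV. G a c f * G f d b - G a d f * G f c b)))))"
proof -
  \<comment> \<open>The terms are sorted by what is differentiated: \<open>Z\<close> contains
    derivatives of the connection, \<open>W\<close> products of two connections, while
    \<open>P\<close>, \<open>Q\<close> and \<open>X\<close> contain the derivatives of the coframe
    that have to disappear.\<close>
  define P where "P k l = (\<Sum>b\<in>UNIV. \<Sum>c\<in>UNIV. \<Theta> b k * \<Theta>' c l j * G a b c)" for k l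
  define Q where "Q k l = (\<Sum>b\<in>UNIV. \<Sum>c\<in>UNIV. \<Theta>' b k l * \<Theta> c j * G a b c)" for k l
  define Z where "Z k l = (\<Sum>b\<in>UNIV. \<Sum>c\<in>UNIV. \<Theta> b l * \<Theta> c j * (\<Sum>d\<in>UNIV. \<Theta> d k * G' d a b c))" for k l
  define W where "W k l = (\<Sum>b\<in>UNIV. \<Sum>c\<in>UNIV. \<Theta> b k * G a b c *
      (\<Sum>d\<in>UNIV. \<Sum>f\<in>UNIV. \<Theta> d l * \<Theta> f j * G c d f))" for k l
  define X where "X k l = (\<Sum>i\<in>UNIV. \<Theta>' a k i * C i l j)" for k l
  have Q_sym: "Q k l = Q l k" for k l
    unfolding Q_def by (simp add: \<Theta>'_sym[of _ k l])
  have 1: "(\<Sum>i\<in>UNIV. \<Theta> a i * C' k i l j) = Q k l + P l k + Z k l + \<Theta>'' k l j - X k l" for k l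
    using dA[of k l j] unfolding Q_def P_def Z_def X_def
    by (simp add: sum.distrib algebra_simps)
  have 2: "(\<Sum>i\<in>UNIV. \<Theta> a i * (\<Sum>s\<in>UNIV. C i k s * C s l j)) = W k l + P k l + X k l" for k l
  proof -
    have "(\<Sum>i\<in>UNIV. \<Theta> a i * (\<Sum>s\<in>UNIV. C i k s * C s l j)) = (\<Sum>s\<in>UNIV. (\<Sum>i\<in>UNIV. \<Theta> a i * C i k s) * C s l j)"
      unfolding sum_distrib_left sum_distrib_right by (subst sum.swap) (simp add: mult_ac)
    also have "\<dots> = (\<Sum>s\<in>UNIV. (\<Sum>b\<in>UNIV. \<Sum>c\<in>UNIV. \<Theta> b k * \<Theta> c s * G a b c) * C s l j) + X k l"
      unfolding AA X_def by (simp add: sum.distrib algebra_simps)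
    also have "(\<Sum>s\<in>UNIV. (\<Sum>b\<in>UNIV. \<Sum>c\<in>UNIV. \<Theta> b k * \<Theta> c s * G a b c) * C s l j) =
        (\<Sum>b\<in>UNIV. \<Sum>c\<in>UNIV. \<Theta> b k * G a b c * (\<Sum>s\<in>UNIV. \<Theta> c s * C s l j))"
      unfolding sum_distrib_left sum_distrib_right
      by (subst sum_swap3[symmetric]) (simp add: mult_ac)
    also have "\<dots> = W k l + P k l"
      unfolding AA W_def P_def by (simp add: sum.distrib algebra_simps)
    finally show ?thesis .
  qed
  have "(\<Sum>i\<in>UNIV. \<Theta> a i * (C' k i l j - C' l i k j + (\<Sum>s\<in>UNIV. C i k s * C s l j - C i l s * C s k j))) =
    (\<Sum>i\<in>UNIV. \<Theta> a i * C' k i l j) - (\<Sum>i\<in>UNIV. \<Theta> a i * C' l i k j)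
    + (\<Sum>i\<in>UNIV. \<Theta> a i * (\<Sum>s\<in>UNIV. C i k s * C s l j)) - (\<Sum>i\<in>UNIV. \<Theta> a i * (\<Sum>s\<in>UNIV. C i l s * C s k j))"
    by (simp add: sum.distrib sum_subtractf algebra_simps)
  \<comment> \<open>\<open>Q\<close> and \<open>\<Theta>''\<close> are symmetric in \<open>k\<close>
    and \<open>l\<close> and drop out of the antisymmetrisation. \<open>X\<close> cancels between
    the derivative and the product terms, and so does \<open>P\<close>, which enters the former with
    its arguments exchanged.\<close>
  also have "\<dots> = Z k l - Z l k + W k l - W l k"
    unfolding 1 2 using Q_sym[of k l] \<Theta>''_sym by simp
  also have "Z k l = (\<Sum>b\<in>UNIV. \<Theta> b j * (\<Sum>c\<in>UNIV. \<Theta> c k * (\<Sum>d\<in>UNIV. \<Theta> d l * G' c a d b)))"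
    unfolding Z_def sum_distrib_left
    by (subst sum.swap, rule sum.cong[OF refl], subst sum.swap) (simp add: mult_ac)
  also have "Z l k = (\<Sum>b\<in>UNIV. \<Theta> b j * (\<Sum>c\<in>UNIV. \<Theta> c k * (\<Sum>d\<in>UNIV. \<Theta> d l * G' d a c b)))"
    unfolding Z_def sum_distrib_left
    by (subst sum.swap) (simp add: mult_ac)
  also have "W k l = (\<Sum>b\<in>UNIV. \<Theta> b j * (\<Sum>c\<in>UNIV. \<Theta> c k * (\<Sum>d\<in>UNIV. \<Theta> d l * (\<Sum>f\<in>UNIV. G a c f * G f d b))))"
  proof -
    have "W k l = (\<Sum>c\<in>UNIV. \<Sum>f\<in>UNIV. \<Sum>d\<in>UNIV. \<Sum>b\<in>UNIV. \<Theta> c k * G a c f * (\<Theta> d l * \<Theta> b j * G f d b))"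
      unfolding W_def sum_distrib_left ..
    also have "\<dots> = (\<Sum>c\<in>UNIV. \<Sum>b\<in>UNIV. \<Sum>d\<in>UNIV. \<Sum>f\<in>UNIV. \<Theta> c k * G a c f * (\<Theta> d l * \<Theta> b j * G f d b))"
      by (rule sum.cong[OF refl], subst sum_swap3, rule sum.cong[OF refl], rule sum.swap)
    also have "\<dots> = (\<Sum>b\<in>UNIV. \<Sum>c\<in>UNIV. \<Sum>d\<in>UNIV. \<Sum>f\<in>UNIV. \<Theta> c k * G a c f * (\<Theta> d l * \<Theta> b j * G f d b))"
      by (rule sum.swap)
    finally show ?thesis unfolding sum_distrib_left by (simp add: mult_ac)
  qed
  also have "W l k = (\<Sum>b\<in>UNIV. \<Theta> b j * (\<Sum>c\<in>UNIV. \<Theta> c k * (\<Sum>d\<in>UNIV. \<Theta> d l * (\<Sum>f\<in>UNIV. G a d f * G f c b))))"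
  proof -
    have "W l k = (\<Sum>d\<in>UNIV. \<Sum>f\<in>UNIV. \<Sum>c\<in>UNIV. \<Sum>b\<in>UNIV. \<Theta> d l * G a d f * (\<Theta> c k * \<Theta> b j * G f c b))"
      unfolding W_def sum_distrib_left ..
    also have "\<dots> = (\<Sum>d\<in>UNIV. \<Sum>b\<in>UNIV. \<Sum>c\<in>UNIV. \<Sum>f\<in>UNIV. \<Theta> d l * G a d f * (\<Theta> c k * \<Theta> b j * G f c b))"
      by (rule sum.cong[OF refl], subst sum_swap3, rule sum.cong[OF refl], rule sum.swap)
    also have "\<dots> = (\<Sum>b\<in>UNIV. \<Sum>c\<in>UNIV. \<Sum>d\<in>UNIV. \<Sum>f\<in>UNIV. \<Theta> d l * G a d f * (\<Theta> c k * \<Theta> b j * G f c b))"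
      by (subst sum.swap, rule sum.cong[OF refl], rule sum.swap)
    finally show ?thesis unfolding sum_distrib_left by (simp add: mult_ac)
  qed
  finally show ?thesis
    by (simp add: sum.distrib sum_subtractf algebra_simps)
qed

section \<open>Complexified matrices and the simultaneous transformation of all four indices\<close>

definition cmat :: "real^'n^'m \<Rightarrow> complex^'n^'m" where
  "cmat A = (\<chi> i j. of_real (A $ i $ j))"

lemma cmat_mult: "cmat (A ** B) = cmat A ** cmat B"
  by (simp add: cmat_def matrix_matrix_mult_def vec_eq_iff)

lemma cmat_one: "cmat (mat 1) = mat 1"
  by (simp add: cmat_def mat_def vec_eq_iff)

lemma det_cmat: "det (cmat A) = of_real (det A)"
  unfolding det_def cmat_def by simp

definition slots :: "complex^'n^'n \<Rightarrow> 'n::finite ctensor4 \<Rightarrow> 'n ctensor4" where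
  "slots A T = slot1 A (slot2 A (slot3 A (slot4 A T)))"

lemma slots_mult: "slots A (slots B T) = slots (A ** B) T"
  unfolding slots_def by (simp add: slot_commute slot_mult)

lemma tensor_inner_slots: "tensor_inner (slots A S) T = tensor_inner S (slots (transpose A) T)"
  unfolding slots_def by (simp add: tensor_inner_slot slot_commute)

lemma slot_one: "slot1 (mat 1) T = T" "slot2 (mat 1) T = T" "slot3 (mat 1) T = T" "slot4 (mat 1) T = T"
  by (auto simp: slot_defs mat_def fun_eq_iff if_distrib if_distribR cong: if_cong)

lemma slots_one: "slots (mat 1) T = T"
  unfolding slots_def by (simp add: slot_one)

lemma slots_eq_sum:
  "slots A T i j k l = (\<Sum>a\<in>UNIV. \<Sum>b\<in>UNIV. \<Sum>c\<in>UNIV. \<Sum>d\<in>UNIV.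
     A $ i $ a * A $ j $ b * A $ k $ c * A $ l $ d * T a b c d)"
  unfolding slots_def slot_defs sum_distrib_left by (simp add: mult_ac)

lemma slots_add: "slots A (\<lambda>i j k l. S i j k l + T i j k l) = (\<lambda>i j k l. slots A S i j k l + slots A T i j k l)"
  and slots_diff: "slots A (\<lambda>i j k l. S i j k l - T i j k l) = (\<lambda>i j k l. slots A S i j k l - slots A T i j k l)"
  and slots_scale: "slots A (\<lambda>i j k l. c * T i j k l) = (\<lambda>i j k l. c * slots A T i j k l)"
  unfolding slots_eq_sum fun_eq_iff
  by (simp_all add: sum.distrib sum_subtractf sum_distrib_left algebra_simps)

definition pull2 :: "complex^'n^'n \<Rightarrow> ('n::finite \<Rightarrow> 'n \<Rightarrow> complex) \<Rightarrow> 'n \<Rightarrow> 'n \<Rightarrow> complex" where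
  "pull2 A S i j = (\<Sum>a\<in>UNIV. \<Sum>b\<in>UNIV. A $ i $ a * A $ j $ b * S a b)"

text \<open>The trace parts of the Weyl tensor are products of two-index tensors. Each pullback
  factorises because the two factors share no index; these two index patterns suffice for all the
  terms.\<close>

lemma slots_product:
  "slots A (\<lambda>i j k l. S i k * T j l) = (\<lambda>i j k l. pull2 A S i k * pull2 A T j l)"
  "slots A (\<lambda>i j k l. S i l * T j k) = (\<lambda>i j k l. pull2 A S i l * pull2 A T j k)"
proof -
  have "pull2 A S i k * pull2 A T j l = slots A (\<lambda>i j k l. S i k * T j l) i j k l" for i j k l
  proof -
    have "pull2 A S i k * pull2 A T j l = (\<Sum>a\<in>UNIV. \<Sum>c\<in>UNIV. \<Sum>b\<in>UNIV. \<Sum>d\<in>UNIV.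
        A $ i $ a * A $ k $ c * S a c * (A $ j $ b * A $ l $ d * T b d))"
      unfolding pull2_def sum_distrib_right unfolding sum_distrib_left ..
    also have "\<dots> = (\<Sum>a\<in>UNIV. \<Sum>b\<in>UNIV. \<Sum>c\<in>UNIV. \<Sum>d\<in>UNIV.
        A $ i $ a * A $ k $ c * S a c * (A $ j $ b * A $ l $ d * T b d))"
      by (rule sum.cong[OF refl]) (rule sum.swap)
    finally show ?thesis unfolding slots_eq_sum by (simp add: mult_ac)
  qed
  then show "slots A (\<lambda>i j k l. S i k * T j l) = (\<lambda>i j k l. pull2 A S i k * pull2 A T j l)"
    by simp
  have "pull2 A S i l * pull2 A T j k = slots A (\<lambda>i j k l. S i l * T j k) i j k l" for i j k l
  proof -
    have "pull2 A S i l * pull2 A T j k = (\<Sum>a\<in>UNIV. \<Sum>d\<in>UNIV. \<Sum>b\<in>UNIV. \<Sum>c\<in>UNIV.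
        A $ i $ a * A $ l $ d * S a d * (A $ j $ b * A $ k $ c * T b c))"
      unfolding pull2_def sum_distrib_right unfolding sum_distrib_left ..
    also have "\<dots> = (\<Sum>a\<in>UNIV. \<Sum>b\<in>UNIV. \<Sum>c\<in>UNIV. \<Sum>d\<in>UNIV.
        A $ i $ a * A $ l $ d * S a d * (A $ j $ b * A $ k $ c * T b c))"
      by (rule sum.cong[OF refl]) (subst sum_swap3, subst sum_swap3, rule refl)
    finally show ?thesis unfolding slots_eq_sum by (simp add: mult_ac)
  qed
  then show "slots A (\<lambda>i j k l. S i l * T j k) = (\<lambda>i j k l. pull2 A S i l * pull2 A T j k)"
    by simp
qed

text \<open>
  \<open>\<theta> a i\<close> is the \<open>i\<close>-th component of the \<open>a\<close>-th covector of a coframe and depends only on the \<open>i\<close>-th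
  coordinate, so the coframe is closed and behaves like \<open>dy\<^sup>a\<close> for complex coordinates \<open>y\<^sup>a\<close>; \<open>h\<close> is
  the metric in this coframe. The coframe may blow up at the boundary of \<open>D\<close>, while \<open>R\<close> is a ring of
  functions that is meant to be regular there.
\<close>

locale complex_coframe =
  fixes g :: "'n::finite metric" and D :: "(real^'n) set" and R :: "(real^'n \<Rightarrow> complex) set"
    and \<theta> \<epsilon> :: "'n \<Rightarrow> 'n \<Rightarrow> complex \<Rightarrow> complex" and h K :: "'n \<Rightarrow> 'n \<Rightarrow> real^'n \<Rightarrow> complex"
  assumes open_D: "open D"
    and R_const: "(\<lambda>_. c) \<in> R"
    and R_add: "F \<in> R \<Longrightarrow> F' \<in> R \<Longrightarrow> (\<lambda>x. F x + F' x) \<in> R"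
    and R_mult: "F \<in> R \<Longrightarrow> F' \<in> R \<Longrightarrow> (\<lambda>x. F x * F' x) \<in> R"
    and R_pd: "F \<in> R \<Longrightarrow> \<exists>F'. (\<forall>a. F' a \<in> R) \<and>
       (\<forall>x\<in>D. \<forall>i. has_pd i F (\<Sum>a\<in>UNIV. \<theta> a i (of_real (x $ i)) * F' a x) x)"
    and h_R: "h a b \<in> R" and K_R: "K a b \<in> R"
    and h_sym: "h a b = h b a"
    and metric: "x \<in> D \<Longrightarrow> of_real (g x $ i $ j) = (\<Sum>a\<in>UNIV. \<Sum>b\<in>UNIV.
       \<theta> a i (of_real (x $ i)) * \<theta> b j (of_real (x $ j)) * h a b x)"
    and K_h: "x \<in> D \<Longrightarrow> (\<chi> a b. K a b x) ** (\<chi> a b. h a b x) = mat 1"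
    and \<theta>_\<epsilon>: "x \<in> D \<Longrightarrow> (\<chi> a i. \<theta> a i (of_real (x $ i))) ** (\<chi> i a. \<epsilon> i a (of_real (x $ a))) = mat 1"
    and \<theta>_analytic: "x \<in> D \<Longrightarrow> \<theta> a i analytic_on {of_real (x $ i)}"
    and \<epsilon>_analytic: "x \<in> D \<Longrightarrow> \<epsilon> i a analytic_on {of_real (x $ a)}"
begin

definition Th :: "'n \<Rightarrow> 'n \<Rightarrow> real^'n \<Rightarrow> complex" where "Th a i x = \<theta> a i (of_real (x $ i))"
definition Ev :: "'n \<Rightarrow> 'n \<Rightarrow> real^'n \<Rightarrow> complex" where "Ev i a x = \<epsilon> i a (of_real (x $ a))"
definition dTh :: "'n \<Rightarrow> 'n \<Rightarrow> 'n \<Rightarrow> real^'n \<Rightarrow> complex" where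
  "dTh a j i x = (if j = i then deriv (\<theta> a i) (of_real (x $ i)) else 0)"
definition ddTh :: "'n \<Rightarrow> 'n \<Rightarrow> 'n \<Rightarrow> 'n \<Rightarrow> real^'n \<Rightarrow> complex" where
  "ddTh a k j i x = (if j = i \<and> k = i then deriv (deriv (\<theta> a i)) (of_real (x $ i)) else 0)"

definition \<Theta> :: "real^'n \<Rightarrow> complex^'n^'n" where "\<Theta> x = (\<chi> a i. Th a i x)"
definition E :: "real^'n \<Rightarrow> complex^'n^'n" where "E x = (\<chi> i a. Ev i a x)"
definition hm :: "real^'n \<Rightarrow> complex^'n^'n" where "hm x = (\<chi> a b. h a b x)"
definition Km :: "real^'n \<Rightarrow> complex^'n^'n" where "Km x = (\<chi> a b. K a b x)"

text \<open>\<open>R_pd\<close> only asserts that frame derivatives exist, so one family is chosen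
  for all indices at once. On \<open>D\<close> it is determined by the invertibility of the coframe;
  beyond \<open>D\<close> what matters is that its members belong to \<open>R\<close>.\<close>

definition Dv :: "'n \<Rightarrow> (real^'n \<Rightarrow> complex) \<Rightarrow> real^'n \<Rightarrow> complex" where
  "Dv a F = (SOME F'. (\<forall>a. F' a \<in> R) \<and>
       (\<forall>x\<in>D. \<forall>i. has_pd i F (\<Sum>a\<in>UNIV. \<theta> a i (of_real (x $ i)) * F' a x) x)) a"

lemma Dv_R: "F \<in> R \<Longrightarrow> Dv a F \<in> R"
  and has_pd_R: "F \<in> R \<Longrightarrow> x \<in> D \<Longrightarrow> has_pd i F (\<Sum>a\<in>UNIV. Th a i x * Dv a F x) x"
  unfolding Dv_def Th_def using someI_ex[OF R_pd] by blast+

lemma has_pd_Th: "x \<in> D \<Longrightarrow> has_pd j (Th a i) (dTh a j i x) x"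
  using has_pd_of_real_component[OF \<theta>_analytic] unfolding Th_def[abs_def] dTh_def .

lemma has_pd_dTh: "x \<in> D \<Longrightarrow> has_pd k (dTh a j i) (ddTh a k j i x) x"
proof (cases "j = i")
  case True
  assume "x \<in> D"
  then show ?thesis
    using has_pd_of_real_component[OF analytic_deriv[OF \<theta>_analytic]] True
    unfolding dTh_def[abs_def] ddTh_def by simp
next
  case False
  then show ?thesis unfolding dTh_def[abs_def] ddTh_def using has_pd_const by simp
qed

lemma has_pd_Ev: "x \<in> D \<Longrightarrow> \<exists>d. has_pd j (Ev i a) d x"
  using has_pd_of_real_component[OF \<epsilon>_analytic] unfolding Ev_def[abs_def] by blast

text \<open>A component depends only on the coordinate of its own index, so its derivatives vanish
  unless all coordinate indices agree. The first equation is the closedness of the coframe.\<close>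

lemma dTh_sym: "dTh a j i x = dTh a i j x"
  and ddTh_sym: "ddTh a k j i x = ddTh a j k i x"
  by (auto simp: dTh_def ddTh_def)

lemma R_sum:
  assumes "finite S" "\<And>s. s \<in> S \<Longrightarrow> F s \<in> R"
  shows "(\<lambda>x. \<Sum>s\<in>S. F s x) \<in> R"
  using assms by (induction rule: finite_induct) (auto intro: R_const R_add)

lemma R_diff: "F \<in> R \<Longrightarrow> F' \<in> R \<Longrightarrow> (\<lambda>x. F x - F' x) \<in> R"
  using R_add[OF _ R_mult[OF R_const[of "-1"]], of F F'] by simp

lemmas R_intros = R_const R_add R_mult R_diff R_sum h_R K_R Dv_R finite

lemma \<Theta>_E: "x \<in> D \<Longrightarrow> \<Theta> x ** E x = mat 1"
  using \<theta>_\<epsilon> unfolding \<Theta>_def E_def Th_def Ev_def .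

lemma E_\<Theta>: "x \<in> D \<Longrightarrow> E x ** \<Theta> x = mat 1"
  using \<Theta>_E matrix_left_right_inverse by blast

lemma Km_hm: "x \<in> D \<Longrightarrow> Km x ** hm x = mat 1"
  using K_h unfolding Km_def hm_def .

lemma metric': "x \<in> D \<Longrightarrow> of_real (g x $ i $ j) = pull2 (transpose (\<Theta> x)) (\<lambda>a b. h a b x) i j"
  unfolding pull2_def by (simp add: \<Theta>_def transpose_def metric Th_def)

lemma cmat_metric:
  assumes "x \<in> D"
  shows "cmat (g x) = transpose (\<Theta> x) ** hm x ** \<Theta> x"
proof -
  have "(\<Sum>a\<in>UNIV. \<Sum>b\<in>UNIV. Th a i x * Th b j x * h a b x) =
     (\<Sum>b\<in>UNIV. (\<Sum>a\<in>UNIV. Th a i x * h a b x) * Th b j x)" for i j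
    unfolding sum_distrib_right by (subst sum.swap) (simp add: mult_ac)
  then show ?thesis
    using metric[OF assms]
    by (simp add: vec_eq_iff cmat_def matrix_matrix_mult_def transpose_def hm_def \<Theta>_def Th_def)
qed

lemma transpose_E_\<Theta>: "x \<in> D \<Longrightarrow> transpose (\<Theta> x) ** transpose (E x) = mat 1"
  "x \<in> D \<Longrightarrow> transpose (E x) ** transpose (\<Theta> x) = mat 1"
  by (metis E_\<Theta> \<Theta>_E matrix_transpose_mul transpose_mat)+

lemma cmat_ginv:
  assumes "x \<in> D"
  shows "cmat (ginv g x) = E x ** Km x ** transpose (E x)"
proof -
  let ?Z = "E x ** Km x ** transpose (E x)"
  have Z: "?Z ** cmat (g x) = mat 1"
  proof -
    have "?Z ** cmat (g x) = E x ** (Km x ** ((transpose (E x) ** transpose (\<Theta> x)) ** hm x)) ** \<Theta> x"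
      unfolding cmat_metric[OF assms] by (simp add: matrix_mul_assoc)
    then show ?thesis
      by (simp add: transpose_E_\<Theta> Km_hm E_\<Theta> assms)
  qed
  \<comment> \<open>\<open>matrix_inv\<close> is defined by choice and is an inverse only once
    invertibility is known. The latter passes from the complexified metric to the real one through
    the determinant.\<close>
  then have "invertible (cmat (g x))"
    using invertible_left_inverse by blast
  then have "invertible (g x)"
    by (simp add: invertible_det_nz det_cmat)
  then have "g x ** ginv g x = mat 1"
    unfolding ginv_def invertible_def matrix_inv_def by (rule someI2_ex) blast
  then have *: "cmat (g x) ** cmat (ginv g x) = mat 1"
    by (metis cmat_mult cmat_one)
  have "cmat (ginv g x) = (?Z ** cmat (g x)) ** cmat (ginv g x)"
    unfolding Z by simp
  also have "\<dots> = ?Z ** (cmat (g x) ** cmat (ginv g x))"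
    by (simp add: matrix_mul_assoc)
  finally show ?thesis unfolding * by simp
qed

lemma Th_ginv_Th:
  assumes "x \<in> D"
  shows "(\<Sum>i\<in>UNIV. \<Sum>l\<in>UNIV. Th d i x * of_real (ginv g x $ i $ l) * Th a l x) = K d a x"
proof -
  have "\<Theta> x ** cmat (ginv g x) ** transpose (\<Theta> x) =
     (\<Theta> x ** E x) ** (Km x ** (transpose (E x) ** transpose (\<Theta> x)))"
    unfolding cmat_ginv[OF assms] by (simp add: matrix_mul_assoc)
  also have "\<dots> = Km x" by (simp add: transpose_E_\<Theta> \<Theta>_E assms)
  finally have "(\<Theta> x ** cmat (ginv g x) ** transpose (\<Theta> x)) $ d $ a = K d a x" by (simp add: Km_def)
  then show ?thesis
    unfolding matrix_matrix_mult_def transpose_def cmat_def \<Theta>_def vec_lambda_beta sum_distrib_right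
    by (subst sum.swap)
qed

text \<open>The Koszul formula for \<open>h\<close>. It has no bracket terms because the frame dual
  to a closed coframe commutes.\<close>

definition conn :: "'n \<Rightarrow> 'n \<Rightarrow> 'n \<Rightarrow> real^'n \<Rightarrow> complex" where
  "conn d b c x = (\<Sum>a\<in>UNIV. K d a x * (1/2 * (Dv b (h a c) x + Dv c (h a b) x - Dv a (h b c) x)))"

lemma conn_R: "conn d b c \<in> R"
  unfolding conn_def[abs_def] by (intro R_intros)

lemma of_real_pd_metric:
  assumes "x \<in> D"
  shows "of_real (pd j (\<lambda>y. g y $ l $ k) x) = (\<Sum>a\<in>UNIV. \<Sum>b\<in>UNIV.
     (dTh a j l x * Th b k x + Th a l x * dTh b j k x) * h a b x
             + Th a l x * Th b k x * (\<Sum>c\<in>UNIV. Th c j x * Dv c (h a b) x))"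
proof (rule of_real_pd[OF open_D assms])
  show "of_real (g y $ l $ k) = (\<Sum>a\<in>UNIV. \<Sum>b\<in>UNIV. Th a l y * Th b k y * h a b y)" if "y \<in> D" for y
    using metric[OF that] unfolding Th_def .
qed (intro has_pd_sum has_pd_mult has_pd_Th has_pd_R h_R assms)

text \<open>The transformation law of a connection. The inhomogeneous term \<open>dTh\<close> need
  not belong to \<open>R\<close>; it is what \<open>curvature_pullback\<close> later
  eliminates.\<close>

lemma christoffel_coframe:
  assumes "x \<in> D"
  shows "(\<Sum>i\<in>UNIV. Th d i x * of_real (christoffel g i j k x)) =
     (\<Sum>b\<in>UNIV. \<Sum>c\<in>UNIV. Th b j x * Th c k x * conn d b c x) + dTh d j k x"
proof -
  define Y where "Y a = (\<Sum>b\<in>UNIV. \<Sum>c\<in>UNIV. Th b j x * Th c k x *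
        (Dv b (h a c) x + Dv c (h a b) x - Dv a (h b c) x)) + 2 * (\<Sum>b\<in>UNIV. h a b x * dTh b j k x)" for a
  have "of_real (christoffel g i j k x) = (\<Sum>l\<in>UNIV. of_real (ginv g x $ i $ l) * (1/2 * (\<Sum>a\<in>UNIV. Th a l x * Y a)))" for i
  proof -
    have "complex_of_real (christoffel g i j k x) = (\<Sum>l\<in>UNIV. of_real (ginv g x $ i $ l) * (1/2 *
       (of_real (pd j (\<lambda>y. g y $ l $ k) x) + of_real (pd k (\<lambda>y. g y $ l $ j) x) - of_real (pd l (\<lambda>y. g y $ j $ k) x))))"
      unfolding christoffel_def by (simp add: sum_distrib_left)
    then show ?thesis
      unfolding Y_def of_real_pd_metric[OF assms]
      by (subst (asm) koszul_pullback) (auto simp: h_sym dTh_sym)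
  qed
  then have "(\<Sum>i\<in>UNIV. Th d i x * of_real (christoffel g i j k x)) =
    (\<Sum>i\<in>UNIV. \<Sum>l\<in>UNIV. \<Sum>a\<in>UNIV. Th d i x * of_real (ginv g x $ i $ l) * Th a l x * (1/2 * Y a))"
    by (simp only: sum_distrib_left mult_ac)
  also have "\<dots> = (\<Sum>a\<in>UNIV. K d a x * (1/2 * Y a))"
    by (subst sum_swap3) (simp only: sum_distrib_right[symmetric] Th_ginv_Th[OF assms])
  also have "\<dots> = (\<Sum>a\<in>UNIV. \<Sum>b\<in>UNIV. \<Sum>c\<in>UNIV. Th b j x * Th c k x *
       (K d a x * (1/2 * (Dv b (h a c) x + Dv c (h a b) x - Dv a (h b c) x))))
     + (\<Sum>a\<in>UNIV. \<Sum>b\<in>UNIV. K d a x * h a b x * dTh b j k x)"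
    unfolding Y_def by (simp add: sum.distrib distrib_left sum_distrib_left mult_ac)
  also have "(\<Sum>a\<in>UNIV. \<Sum>b\<in>UNIV. K d a x * h a b x * dTh b j k x) = (\<Sum>b\<in>UNIV. (Km x ** hm x) $ d $ b * dTh b j k x)"
    unfolding matrix_matrix_mult_def Km_def hm_def by (subst sum.swap) (simp add: sum_distrib_right)
  also have "\<dots> = dTh d j k x"
    by (simp add: Km_hm assms mat_def if_distrib if_distribR cong: if_cong)
  also have "(\<Sum>a\<in>UNIV. \<Sum>b\<in>UNIV. \<Sum>c\<in>UNIV. Th b j x * Th c k x *
       (K d a x * (1/2 * (Dv b (h a c) x + Dv c (h a b) x - Dv a (h b c) x)))) =
     (\<Sum>b\<in>UNIV. \<Sum>c\<in>UNIV. Th b j x * Th c k x * conn d b c x)"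
    unfolding conn_def sum_distrib_left by (subst sum_swap3[symmetric]) (rule refl)
  finally show ?thesis .
qed

lemma E_Th_inverse:
  assumes "x \<in> D"
  shows "(\<Sum>a\<in>UNIV. Ev i a x * (\<Sum>j\<in>UNIV. Th a j x * f j)) = f i"
proof -
  have "(\<Sum>a\<in>UNIV. Ev i a x * (\<Sum>j\<in>UNIV. Th a j x * f j)) = (\<Sum>j\<in>UNIV. (E x ** \<Theta> x) $ i $ j * f j)"
    unfolding matrix_matrix_mult_def E_def \<Theta>_def vec_lambda_beta sum_distrib_left sum_distrib_right
    by (subst sum.swap) (simp add: mult_ac)
  then show ?thesis
    by (simp add: E_\<Theta> assms mat_def if_distrib if_distribR cong: if_cong)
qed

lemma has_pd_conn_coframe:
  assumes "x \<in> D"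
  shows "has_pd k (\<lambda>y. (\<Sum>b\<in>UNIV. \<Sum>c\<in>UNIV. Th b l y * Th c j y * conn a b c y) + dTh a l j y)
     ((\<Sum>b\<in>UNIV. \<Sum>c\<in>UNIV. (dTh b k l x * Th c j x + Th b l x * dTh c k j x) * conn a b c x
          + Th b l x * Th c j x * (\<Sum>d\<in>UNIV. Th d k x * Dv d (conn a b c) x)) + ddTh a k l j x) x"
  by (intro has_pd_sum has_pd_mult has_pd_add has_pd_Th has_pd_dTh has_pd_R conn_R assms)

text \<open>Solving \<open>christoffel_coframe\<close> for the Christoffel symbols with the dual
  frame presents them as sums and products of differentiable functions. Analyticity of the dual
  frame enters here; without differentiability the value of \<open>pd\<close> would carry no
  information.\<close>

lemma christoffel_differentiable:
  assumes "x \<in> D"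
  shows "has_pd k (\<lambda>y. of_real (christoffel g i l j y)) (of_real (pd k (christoffel g i l j) x)) x"
proof -
  let ?A = "\<lambda>y. \<Sum>a\<in>UNIV. Ev i a y * ((\<Sum>b\<in>UNIV. \<Sum>c\<in>UNIV. Th b l y * Th c j y * conn a b c y) + dTh a l j y)"
  have eq: "of_real (christoffel g i l j y) = ?A y" if "y \<in> D" for y
    unfolding christoffel_coframe[OF that, symmetric] E_Th_inverse[OF that] ..
  obtain e where e: "has_pd k (Ev i a) (e a) x" for a
    using has_pd_Ev[OF assms] by metis
  have "\<exists>d. has_pd k ?A d x"
    by (rule exI, rule has_pd_sum, rule has_pd_mult[OF e has_pd_conn_coframe[OF assms]])
  then obtain d where d: "has_pd k ?A d x" ..
  have "of_real (pd k (christoffel g i l j) x) = d"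
    by (rule of_real_pd[OF open_D assms eq d])
  then show ?thesis
    using has_pd_cong[OF open_D assms eq] d by simp
qed

definition curv :: "'n \<Rightarrow> 'n \<Rightarrow> 'n \<Rightarrow> 'n \<Rightarrow> real^'n \<Rightarrow> complex" where
  "curv a b c d x = Dv c (conn a d b) x - Dv d (conn a c b) x
     + (\<Sum>f\<in>UNIV. conn a c f x * conn f d b x - conn a d f x * conn f c b x)"

lemma curv_R: "curv a b c d \<in> R"
  unfolding curv_def[abs_def] by (intro R_intros conn_R)

lemma riemann_up_coframe:
  assumes "x \<in> D"
  shows "(\<Sum>i\<in>UNIV. Th a i x * of_real (riemann_up g i j k l x)) =
    slot2 (transpose (\<Theta> x)) (slot3 (transpose (\<Theta> x)) (slot4 (transpose (\<Theta> x)) (\<lambda>a b c d. curv a b c d x))) a j k l"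
proof -
  \<comment> \<open>Both sides are derivatives of the same function, since
    \<open>christoffel_coframe\<close> holds on an open set; uniqueness of derivatives equates
    them.\<close>
  have dA: "(\<Sum>i\<in>UNIV. dTh a k i x * of_real (christoffel g i l j x) + Th a i x * of_real (pd k (christoffel g i l j) x)) =
       (\<Sum>b\<in>UNIV. \<Sum>c\<in>UNIV. (dTh b k l x * Th c j x + Th b l x * dTh c k j x) * conn a b c x
          + Th b l x * Th c j x * (\<Sum>d\<in>UNIV. Th d k x * Dv d (conn a b c) x)) + ddTh a k l j x" for k l j
  proof (rule has_pd_unique)
    show "has_pd k (\<lambda>y. \<Sum>i\<in>UNIV. Th a i y * of_real (christoffel g i l j y)) (\<Sum>i\<in>UNIV. dTh a k i x * of_real (christoffel g i l j x) + Th a i x * of_real (pd k (christoffel g i l j) x)) x"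
      by (intro has_pd_sum has_pd_mult has_pd_Th christoffel_differentiable assms)
    show "has_pd k (\<lambda>y. \<Sum>i\<in>UNIV. Th a i y * of_real (christoffel g i l j y)) ((\<Sum>b\<in>UNIV. \<Sum>c\<in>UNIV. (dTh b k l x * Th c j x + Th b l x * dTh c k j x) * conn a b c x
          + Th b l x * Th c j x * (\<Sum>d\<in>UNIV. Th d k x * Dv d (conn a b c) x)) + ddTh a k l j x) x"
      by (rule iffD2[OF has_pd_cong[OF open_D assms christoffel_coframe] has_pd_conn_coframe[OF assms]])
  qed
  have "(\<Sum>i\<in>UNIV. Th a i x * of_real (riemann_up g i j k l x)) = (\<Sum>i\<in>UNIV. Th a i x *
     (of_real (pd k (christoffel g i l j) x) - of_real (pd l (christoffel g i k j) x)
     + (\<Sum>s\<in>UNIV. of_real (christoffel g i k s x) * of_real (christoffel g s l j x)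
                 - of_real (christoffel g i l s x) * of_real (christoffel g s k j x))))"
    unfolding riemann_up_def by simp
  also have "\<dots> = (\<Sum>b\<in>UNIV. Th b j x * (\<Sum>c\<in>UNIV. Th c k x * (\<Sum>d\<in>UNIV. Th d l x *
        (Dv c (conn a d b) x - Dv d (conn a c b) x + (\<Sum>f\<in>UNIV. conn a c f x * conn f d b x - conn a d f x * conn f c b x)))))"
    by (rule curvature_pullback[where \<Theta>' = "\<lambda>a j i. dTh a j i x" and \<Theta>'' = "\<lambda>k l j. ddTh a k l j x"])
      (rule dTh_sym ddTh_sym christoffel_coframe[OF assms] dA)+
  finally show ?thesis
    unfolding slot_defs \<Theta>_def curv_def transpose_def by simp
qed

end

section \<open>Riemann, Ricci and Weyl tensors in the coframe\<close>

lemma trace_slots: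
  assumes "transpose B ** A = mat 1"
  shows "(\<Sum>i\<in>UNIV. slot1 A (slot3 B T) i j i l) = (\<Sum>a\<in>UNIV. T a j a l)"
proof -
  have "(\<Sum>i\<in>UNIV. slot1 A (slot3 B T) i j i l) = (\<Sum>i\<in>UNIV. \<Sum>a\<in>UNIV. \<Sum>c\<in>UNIV. B $ i $ c * A $ i $ a * T a j c l)"
    unfolding slot_defs sum_distrib_left by (simp add: mult_ac)
  also have "\<dots> = (\<Sum>a\<in>UNIV. \<Sum>c\<in>UNIV. (transpose B ** A) $ c $ a * T a j c l)"
    unfolding matrix_matrix_mult_def transpose_def vec_lambda_beta sum_distrib_right
    by (rule sum_swap3[symmetric])
  finally show ?thesis
    by (simp add: assms mat_def if_distrib if_distribR cong: if_cong)
qed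

context complex_coframe
begin

lemma riemann_coframe:
  assumes "x \<in> D"
  shows "(\<lambda>i j k l. complex_of_real (riemann g i j k l x)) =
    slots (transpose (\<Theta> x)) (slot1 (hm x) (\<lambda>a b c d. curv a b c d x))"
proof -
  let ?T = "slot2 (transpose (\<Theta> x)) (slot3 (transpose (\<Theta> x)) (slot4 (transpose (\<Theta> x)) (\<lambda>a b c d. curv a b c d x)))"
  have "complex_of_real (riemann g i j k l x) = slot1 (transpose (\<Theta> x)) (slot1 (hm x) ?T) i j k l" for i j k l
  proof -
    have "complex_of_real (riemann g i j k l x) = (\<Sum>s\<in>UNIV. of_real (g x $ i $ s) * of_real (riemann_up g s j k l x))"
      unfolding riemann_def by simp
    also have "\<dots> = (\<Sum>s\<in>UNIV. \<Sum>a\<in>UNIV. \<Sum>b\<in>UNIV. Th a i x * (h a b x * (Th b s x * of_real (riemann_up g s j k l x))))"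
      unfolding metric[OF assms] Th_def sum_distrib_right by (simp add: mult_ac)
    also have "\<dots> = (\<Sum>a\<in>UNIV. Th a i x * (\<Sum>b\<in>UNIV. h a b x * (\<Sum>s\<in>UNIV. Th b s x * of_real (riemann_up g s j k l x))))"
      unfolding sum_distrib_left by (rule sum_swap3[symmetric])
    also have "\<dots> = slot1 (transpose (\<Theta> x)) (slot1 (hm x) ?T) i j k l"
      unfolding riemann_up_coframe[OF assms] by (simp add: slot1_def transpose_def \<Theta>_def hm_def)
    finally show ?thesis .
  qed
  then show ?thesis
    unfolding slots_def by (simp add: slot_commute fun_eq_iff)
qed

definition Ric :: "'n \<Rightarrow> 'n \<Rightarrow> real^'n \<Rightarrow> complex" where
  "Ric b d x = (\<Sum>a\<in>UNIV. curv a b a d x)"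

definition Scal :: "real^'n \<Rightarrow> complex" where
  "Scal x = (\<Sum>b\<in>UNIV. \<Sum>d\<in>UNIV. K b d x * Ric b d x)"

lemma Ric_R: "Ric b d \<in> R"
  unfolding Ric_def[abs_def] by (intro R_intros curv_R)

lemma Scal_R: "Scal \<in> R"
  unfolding Scal_def[abs_def] by (intro R_intros Ric_R)

lemma ricci_coframe:
  assumes "x \<in> D"
  shows "complex_of_real (ricci g j l x) = pull2 (transpose (\<Theta> x)) (\<lambda>b d. Ric b d x) j l"
proof -
  let ?T = "slot2 (transpose (\<Theta> x)) (slot4 (transpose (\<Theta> x)) (\<lambda>a b c d. curv a b c d x))"
  have "complex_of_real (riemann_up g i j i l x) = slot1 (E x) (slot3 (transpose (\<Theta> x)) ?T) i j i l" for i
  proof -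
    have "complex_of_real (riemann_up g i j i l x) =
       (\<Sum>a\<in>UNIV. Ev i a x * (\<Sum>s\<in>UNIV. Th a s x * of_real (riemann_up g s j i l x)))"
      by (simp only: E_Th_inverse[OF assms])
    then show ?thesis
      unfolding riemann_up_coframe[OF assms] by (simp add: slot1_def E_def slot_commute)
  qed
  then have "complex_of_real (ricci g j l x) = (\<Sum>i\<in>UNIV. slot1 (E x) (slot3 (transpose (\<Theta> x)) ?T) i j i l)"
    unfolding ricci_def by simp
  also have "\<dots> = (\<Sum>a\<in>UNIV. ?T a j a l)"
    by (rule trace_slots) (simp add: \<Theta>_E assms)
  also have "\<dots> = pull2 (transpose (\<Theta> x)) (\<lambda>b d. Ric b d x) j l"
    unfolding slot_defs pull2_def Ric_def sum_distrib_left
    by (subst sum_swap3[symmetric]) (simp add: mult_ac)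
  finally show ?thesis .
qed

lemma scalar_curvature_coframe:
  assumes "x \<in> D"
  shows "complex_of_real (scalar_curvature g x) = Scal x"
proof -
  let ?f = "\<lambda>b d i j. Th b i x * of_real (ginv g x $ i $ j) * Th d j x * Ric b d x"
  have "complex_of_real (scalar_curvature g x) = (\<Sum>i\<in>UNIV. \<Sum>j\<in>UNIV. \<Sum>b\<in>UNIV. \<Sum>d\<in>UNIV. ?f b d i j)"
    unfolding scalar_curvature_def
    by (simp add: ricci_coframe[OF assms] pull2_def transpose_def \<Theta>_def sum_distrib_left mult_ac)
  also have "\<dots> = (\<Sum>b\<in>UNIV. \<Sum>i\<in>UNIV. \<Sum>j\<in>UNIV. \<Sum>d\<in>UNIV. ?f b d i j)"
    by (rule sum_swap3)
  also have "\<dots> = (\<Sum>b\<in>UNIV. \<Sum>d\<in>UNIV. \<Sum>i\<in>UNIV. \<Sum>j\<in>UNIV. ?f b d i j)"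
    by (rule sum.cong[OF refl], rule sum_swap3)
  also have "\<dots> = Scal x"
    by (simp only: sum_distrib_right[symmetric] Th_ginv_Th[OF assms] Scal_def)
  finally show ?thesis .
qed

text \<open>The Weyl tensor of \<open>h\<close>. The factors are ordered so that every product has
  one of the two index patterns of \<open>slots_product\<close>.\<close>

definition weylt :: "real^'n \<Rightarrow> 'n ctensor4" where
  "weylt x a b c d = slot1 (hm x) (\<lambda>a b c d. curv a b c d x) a b c d
     - 1 / (of_nat CARD('n) - 2) *
         (h a c x * Ric b d x - h a d x * Ric b c x - Ric a d x * h b c x + Ric a c x * h b d x)
     + Scal x / ((of_nat CARD('n) - 1) * (of_nat CARD('n) - 2)) *
         (h a c x * h b d x - h a d x * h b c x)"

lemma weylt_R: "(\<lambda>x. weylt x a b c d) \<in> R"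
  unfolding weylt_def slot1_def hm_def vec_lambda_beta divide_inverse
  by (intro R_intros curv_R Ric_R Scal_R)

lemma weyl_coframe:
  assumes "x \<in> D"
  shows "(\<lambda>i j k l. complex_of_real (weyl g i j k l x)) = slots (transpose (\<Theta> x)) (weylt x)"
proof -
  have r: "complex_of_real (riemann g i j k l x) =
    slots (transpose (\<Theta> x)) (slot1 (hm x) (\<lambda>a b c d. curv a b c d x)) i j k l" for i j k l
    using riemann_coframe[OF assms] by (simp add: fun_eq_iff)
  show ?thesis
    unfolding weylt_def[abs_def] slots_add slots_diff slots_scale slots_product weyl_def
    by (simp add: r ricci_coframe[OF assms] scalar_curvature_coframe[OF assms] metric'[OF assms] mult_ac)
qed

lemma slots_R:
  assumes "\<And>a b. (\<lambda>x. A x $ a $ b) \<in> R" "\<And>a b c d. (\<lambda>x. T x a b c d) \<in> R"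
  shows "(\<lambda>x. slots (A x) (T x) a b c d) \<in> R"
  unfolding slots_def slot_defs by (intro R_intros assms)

lemma Km_R: "(\<lambda>x. Km x $ a $ b) \<in> R"
  unfolding Km_def by (simp add: K_R)

lemma tensor_inner_R:
  assumes "\<And>a b c d. (\<lambda>x. S x a b c d) \<in> R" "\<And>a b c d. (\<lambda>x. T x a b c d) \<in> R"
  shows "(\<lambda>x. tensor_inner (S x) (T x)) \<in> R"
  unfolding tensor_inner_def by (intro R_intros assms)

end

subsection \<open>Dimension four: the dual Weyl tensor\<close>

lemma det_4:
  "det (A::'a::comm_ring_1^4^4) =
    A$1$1 * (A$2$2 * (A$3$3 * A$4$4 - A$3$4 * A$4$3) - A$2$3 * (A$3$2 * A$4$4 - A$3$4 * A$4$2) + A$2$4 * (A$3$2 * A$4$3 - A$3$3 * A$4$2))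
  - A$1$2 * (A$2$1 * (A$3$3 * A$4$4 - A$3$4 * A$4$3) - A$2$3 * (A$3$1 * A$4$4 - A$3$4 * A$4$1) + A$2$4 * (A$3$1 * A$4$3 - A$3$3 * A$4$1))
  + A$1$3 * (A$2$1 * (A$3$2 * A$4$4 - A$3$4 * A$4$2) - A$2$2 * (A$3$1 * A$4$4 - A$3$4 * A$4$1) + A$2$4 * (A$3$1 * A$4$2 - A$3$2 * A$4$1))
  - A$1$4 * (A$2$1 * (A$3$2 * A$4$3 - A$3$3 * A$4$2) - A$2$2 * (A$3$1 * A$4$3 - A$3$3 * A$4$1) + A$2$3 * (A$3$1 * A$4$2 - A$3$2 * A$4$1))"
proof -
  have f1234: "finite {2::4, 3, 4}" "1 \<notin> {2::4, 3, 4}" by auto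
  have f234: "finite {3::4, 4}" "2 \<notin> {3::4, 4}" by auto
  have f34: "finite {4::4}" "3 \<notin> {4::4}" by auto
  show ?thesis
    unfolding det_def UNIV_4
    unfolding sum_over_permutations_insert[OF f1234]
    unfolding sum_over_permutations_insert[OF f234]
    unfolding sum_over_permutations_insert[OF f34]
    unfolding permutes_sing
    by (simp add: sign_swap_id permutation_swap_id permutation_compose sign_compose sign_id swap_id_eq algebra_simps)
qed

lemma vector_4 [simp]:
 "(vector [x,y,z,w] ::('a::zero)^4)$1 = x"
 "(vector [x,y,z,w] ::('a::zero)^4)$2 = y"
 "(vector [x,y,z,w] ::('a::zero)^4)$3 = z"
 "(vector [x,y,z,w] ::('a::zero)^4)$4 = w"
  unfolding vector_def by simp_all

definition eps :: "4 \<Rightarrow> 4 \<Rightarrow> 4 \<Rightarrow> 4 \<Rightarrow> complex" where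
  "eps i j k l = of_real (levi_civita_symbol i j k l)"

lemma eps_eq: "eps i j k l = det (vector [axis i 1, axis j 1, axis k 1, axis l 1] :: complex^4^4)"
  unfolding eps_def levi_civita_symbol_def by (simp add: det_4 axis_def)

lemma sum_det_axis:
  fixes u v w z :: "complex^4"
  shows "(\<Sum>i\<in>UNIV. u $ i * det (vector [axis i 1, v, w, z] :: complex^4^4)) = det (vector [u, v, w, z] :: complex^4^4)"
    "(\<Sum>i\<in>UNIV. v $ i * det (vector [u, axis i 1, w, z] :: complex^4^4)) = det (vector [u, v, w, z] :: complex^4^4)"
    "(\<Sum>i\<in>UNIV. w $ i * det (vector [u, v, axis i 1, z] :: complex^4^4)) = det (vector [u, v, w, z] :: complex^4^4)"
    "(\<Sum>i\<in>UNIV. z $ i * det (vector [u, v, w, axis i 1] :: complex^4^4)) = det (vector [u, v, w, z] :: complex^4^4)"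
  unfolding sum_4 by (simp_all add: det_4 axis_def algebra_simps)

lemma sum_eps:
  fixes u v w z :: "complex^4"
  shows "(\<Sum>i\<in>UNIV. \<Sum>j\<in>UNIV. \<Sum>k\<in>UNIV. \<Sum>l\<in>UNIV. u $ i * v $ j * w $ k * z $ l * eps i j k l) =
    det (vector [u, v, w, z] :: complex^4^4)"
  unfolding eps_eq mult.assoc sum_distrib_left[symmetric] by (simp only: sum_det_axis)

text \<open>The sum is the determinant of the rows \<open>a\<close>, \<open>b\<close>,
  \<open>c\<close>, \<open>d\<close> of \<open>A\<close>. These rows form the product of a matrix of
  unit vectors with \<open>A\<close>, and the determinant is multiplicative.\<close>

lemma sum_eps_matrix:
  fixes A :: "complex^4^4"
  shows "(\<Sum>i\<in>UNIV. \<Sum>j\<in>UNIV. \<Sum>k\<in>UNIV. \<Sum>l\<in>UNIV. A $ a $ i * A $ b $ j * A $ c $ k * A $ d $ l * eps i j k l) =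
    det A * eps a b c d"
proof -
  have ax: "(\<Sum>k\<in>UNIV. axis a 1 $ k * A $ k $ j) = A $ a $ j" for a j
    by (simp add: axis_def if_distrib if_distribR cong: if_cong)
  have "(vector [axis a 1, axis b 1, axis c 1, axis d 1] :: complex^4^4) ** A = vector [A $ a, A $ b, A $ c, A $ d]"
  proof (rule vec_eq_iff[THEN iffD2], rule allI)
    fix r :: 4
    show "((vector [axis a 1, axis b 1, axis c 1, axis d 1] :: complex^4^4) ** A) $ r = vector [A $ a, A $ b, A $ c, A $ d] $ r"
      using exhaust_4[of r] by (elim disjE) (simp_all add: vec_eq_iff matrix_matrix_mult_def ax)
  qed
  then show ?thesis
    unfolding sum_eps unfolding eps_eq using det_mul[of "vector [axis a 1, axis b 1, axis c 1, axis d 1]" A]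
    by (simp only: mult.commute)
qed

definition eps_slots :: "4 ctensor4 \<Rightarrow> 4 ctensor4" where
  "eps_slots T i j k l = (\<Sum>s\<in>UNIV. \<Sum>t\<in>UNIV. eps i j s t * T s t k l)"

lemma eps_slots_commute:
  "eps_slots (slot3 A T) = slot3 A (eps_slots T)"
  "eps_slots (slot4 A T) = slot4 A (eps_slots T)"
  unfolding eps_slots_def slot_defs fun_eq_iff sum_distrib_left
  by (intro allI, subst sum_swap3, simp add: mult_ac)+

text \<open>The symbol \<open>eps\<close> is a tensor density, so a change of frame costs one
  determinant. \<open>I2_coframe\<close> combines it with the square root in the Levi-Civita
  tensor.\<close>

lemma eps_slots_transform:
  "slot1 (transpose A) (slot2 (transpose A) (eps_slots (slot1 A (slot2 A T)))) =
    (\<lambda>i j k l. det A * eps_slots T i j k l)"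
proof -
  have "slot1 (transpose A) (slot2 (transpose A) (eps_slots (slot1 A (slot2 A T)))) i j k l =
     det A * eps_slots T i j k l" for i j k l
  proof -
    let ?B = "transpose A"
    let ?f = "\<lambda>a b s t c d. ?B $ i $ a * ?B $ j $ b * ?B $ c $ s * ?B $ d $ t * eps a b s t * T c d k l"
    have "slot1 ?B (slot2 ?B (eps_slots (slot1 A (slot2 A T)))) i j k l =
      (\<Sum>a\<in>UNIV. \<Sum>b\<in>UNIV. \<Sum>s\<in>UNIV. \<Sum>t\<in>UNIV. \<Sum>c\<in>UNIV. \<Sum>d\<in>UNIV. ?f a b s t c d)"
      unfolding eps_slots_def slot_defs sum_distrib_left by (simp add: transpose_def mult_ac)
    also have "\<dots> = (\<Sum>a\<in>UNIV. \<Sum>b\<in>UNIV. \<Sum>c\<in>UNIV. \<Sum>s\<in>UNIV. \<Sum>t\<in>UNIV. \<Sum>d\<in>UNIV. ?f a b s t c d)"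
      by (rule sum.cong[OF refl], rule sum.cong[OF refl], rule sum_swap3)
    also have "\<dots> = (\<Sum>c\<in>UNIV. \<Sum>a\<in>UNIV. \<Sum>b\<in>UNIV. \<Sum>s\<in>UNIV. \<Sum>t\<in>UNIV. \<Sum>d\<in>UNIV. ?f a b s t c d)"
      by (rule sum_swap3)
    also have "\<dots> = (\<Sum>c\<in>UNIV. \<Sum>a\<in>UNIV. \<Sum>b\<in>UNIV. \<Sum>d\<in>UNIV. \<Sum>s\<in>UNIV. \<Sum>t\<in>UNIV. ?f a b s t c d)"
      by (rule sum.cong[OF refl], rule sum.cong[OF refl], rule sum.cong[OF refl], rule sum_swap3)
    also have "\<dots> = (\<Sum>c\<in>UNIV. \<Sum>d\<in>UNIV. \<Sum>a\<in>UNIV. \<Sum>b\<in>UNIV. \<Sum>s\<in>UNIV. \<Sum>t\<in>UNIV. ?f a b s t c d)"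
      by (rule sum.cong[OF refl], rule sum_swap3)
    also have "\<dots> = (\<Sum>c\<in>UNIV. \<Sum>d\<in>UNIV. det ?B * eps i j c d * T c d k l)"
      by (simp only: sum_distrib_right[symmetric] sum_eps_matrix)
    finally show ?thesis
      unfolding eps_slots_def by (simp add: sum_distrib_left mult_ac)
  qed
  then show ?thesis by (simp add: fun_eq_iff)
qed

lemma tensor_inner_scale_left: "tensor_inner (\<lambda>i j k l. c * S i j k l) T = c * tensor_inner S T"
  unfolding tensor_inner_def sum_distrib_left by (simp add: mult_ac)

locale complex_coframe4 = complex_coframe g D R \<theta> \<epsilon> h K
  for g :: "4 metric" and D R \<theta> \<epsilon> h K
begin

definition weylt_up :: "real^4 \<Rightarrow> 4 ctensor4" where
  "weylt_up x = slots (Km x) (weylt x)"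

definition weylt_up12 :: "real^4 \<Rightarrow> 4 ctensor4" where
  "weylt_up12 x = slot1 (Km x) (slot2 (Km x) (weylt x))"

definition dual_contraction :: "real^4 \<Rightarrow> complex" where
  "dual_contraction x = 1/2 * tensor_inner (eps_slots (weylt_up12 x)) (weylt_up x)"

definition contraction :: "real^4 \<Rightarrow> complex" where
  "contraction x = tensor_inner (weylt x) (weylt_up x)"

lemma weylt_up_R: "(\<lambda>x. weylt_up x a b c d) \<in> R"
  unfolding weylt_up_def by (intro slots_R Km_R weylt_R)

lemma contraction_R: "contraction \<in> R"
  unfolding contraction_def[abs_def] by (intro tensor_inner_R weylt_R weylt_up_R)

lemma dual_contraction_R: "dual_contraction \<in> R"
  unfolding dual_contraction_def[abs_def] weylt_up12_def
  by (intro R_mult R_const tensor_inner_R weylt_up_R)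
     (unfold eps_slots_def slot_defs, intro R_intros Km_R weylt_R)

lemma raise_all_weyl:
  assumes "x \<in> D"
  shows "(\<lambda>i j k l. complex_of_real (raise_all g (weyl g) i j k l x)) = slots (E x) (weylt_up x)"
proof -
  have "complex_of_real (raise_all g (weyl g) i j k l x) =
     slots (cmat (ginv g x)) (\<lambda>i j k l. complex_of_real (weyl g i j k l x)) i j k l" for i j k l
    unfolding raise_all_def slots_eq_sum by (simp add: cmat_def)
  moreover have "cmat (ginv g x) ** transpose (\<Theta> x) = E x ** (Km x ** (transpose (E x) ** transpose (\<Theta> x)))"
    unfolding cmat_ginv[OF assms] by (simp add: matrix_mul_assoc)
  ultimately show ?thesis
    unfolding weyl_coframe[OF assms] weylt_up_def slots_mult
    by (simp add: transpose_E_\<Theta>[OF assms])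
qed

lemma I1_coframe:
  assumes "x \<in> D"
  shows "complex_of_real (I1 g x) = contraction x"
proof -
  have "complex_of_real (I1 g x) = tensor_inner (\<lambda>i j k l. complex_of_real (weyl g i j k l x))
      (\<lambda>i j k l. complex_of_real (raise_all g (weyl g) i j k l x))"
    unfolding I1_def tensor_inner_def by simp
  then show ?thesis
    unfolding raise_all_weyl[OF assms] weyl_coframe[OF assms] contraction_def
    by (simp add: tensor_inner_slots slots_mult \<Theta>_E[OF assms] slots_one)
qed

text \<open>All coframe matrices cancel except for the determinant produced by \<open>eps\<close>.
  The factor in front of \<open>dual_contraction\<close> squares to the determinant of
  \<open>h\<close> up to sign, so its own poles cancel; that it is regular is shown later from
  explicit determinants.\<close>

lemma I2_coframe:
  assumes "x \<in> D"
  shows "complex_of_real (I2 g x) = of_real (sqrt \<bar>det (g x)\<bar>) * det (E x) * dual_contraction x"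
proof -
  let ?c = "complex_of_real (sqrt \<bar>det (g x)\<bar>)" and ?T = "transpose (\<Theta> x)"
  let ?G = "cmat (ginv g x)"
  have G\<Theta>: "?G ** ?T = E x ** Km x"
  proof -
    have "?G ** ?T = E x ** (Km x ** (transpose (E x) ** ?T))"
      unfolding cmat_ginv[OF assms] by (simp add: matrix_mul_assoc)
    then show ?thesis by (simp add: transpose_E_\<Theta>[OF assms])
  qed
  have up12: "(\<lambda>i j k l. complex_of_real (raise12 g (weyl g) i j k l x)) =
     slot1 (E x) (slot2 (E x) (slot3 ?T (slot4 ?T (weylt_up12 x))))"
  proof -
    have "(\<lambda>i j k l. complex_of_real (raise12 g (weyl g) i j k l x)) =
      slot1 ?G (slot2 ?G (\<lambda>i j k l. complex_of_real (weyl g i j k l x)))"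
      unfolding raise12_def slot_defs fun_eq_iff sum_distrib_left by (simp add: cmat_def mult_ac)
    then show ?thesis
      unfolding weyl_coframe[OF assms] slots_def weylt_up12_def
      by (simp add: slot_commute slot_mult G\<Theta>)
  qed
  have "complex_of_real (dual_weyl g i j k l x) = 1/2 * ?c *
     eps_slots (\<lambda>i j k l. complex_of_real (raise12 g (weyl g) i j k l x)) i j k l" for i j k l
    unfolding dual_weyl_def levi_civita_def eps_slots_def eps_def
    by (simp add: sum_distrib_left mult_ac)
  then have "complex_of_real (I2 g x) = tensor_inner
     (\<lambda>i j k l. 1/2 * ?c * eps_slots (\<lambda>i j k l. complex_of_real (raise12 g (weyl g) i j k l x)) i j k l)
     (\<lambda>i j k l. complex_of_real (raise_all g (weyl g) i j k l x))"
    by (simp only: I2_def tensor_inner_def of_real_sum of_real_mult)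
  also have "\<dots> = 1/2 * ?c * tensor_inner (eps_slots (slot1 (E x) (slot2 (E x) (slot3 ?T (slot4 ?T (weylt_up12 x)))))) (slots (E x) (weylt_up x))"
    unfolding up12 raise_all_weyl[OF assms] tensor_inner_scale_left ..
  also have "tensor_inner (eps_slots (slot1 (E x) (slot2 (E x) (slot3 ?T (slot4 ?T (weylt_up12 x)))))) (slots (E x) (weylt_up x)) =
     tensor_inner (slot1 (transpose (E x)) (slot2 (transpose (E x)) (eps_slots (slot1 (E x) (slot2 (E x) (slot3 ?T (slot4 ?T (weylt_up12 x))))))))
       (slot3 (E x) (slot4 (E x) (weylt_up x)))"
    unfolding slots_def by (simp add: tensor_inner_slot slot_commute)
  also have "\<dots> = det (E x) * tensor_inner (eps_slots (weylt_up12 x)) (weylt_up x)"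
    unfolding eps_slots_transform tensor_inner_scale_left
    by (simp add: eps_slots_commute tensor_inner_slot slot_commute slot_mult \<Theta>_E[OF assms] slot_one)
  finally show ?thesis
    unfolding dual_contraction_def by simp
qed

end

subsection \<open>Functions regular at the horizons and on the axis\<close>

lemma has_pd_inverse:
  assumes "has_pd i f d x" "f x \<noteq> 0"
  shows "has_pd i (\<lambda>y. inverse (f y)) (- (d * (inverse (f x) * inverse (f x)))) x"
proof -
  have "((inverse \<circ> (\<lambda>h. f (x + h *\<^sub>R axis i 1))) has_vector_derivative
      d * - (inverse (f (x + 0 *\<^sub>R axis i 1)) * 1 * inverse (f (x + 0 *\<^sub>R axis i 1)))) (at 0)"
    using assms unfolding has_pd_def
    by (intro field_vector_diff_chain_at DERIV_inverse' DERIV_ident) auto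
  then show ?thesis by (simp add: has_pd_def o_def)
qed

text \<open>Neither \<open>Q\<close>, \<open>P\<close> nor \<open>sin \<theta>\<close> is inverted here, so these functions are regular at the horizons and on the axis.\<close>

inductive_set bh_ring :: "real \<Rightarrow> real \<Rightarrow> (real^4 \<Rightarrow> complex) set" for a \<alpha> where
  bh_ring_const: "(\<lambda>_. c) \<in> bh_ring a \<alpha>"
| bh_ring_r: "(\<lambda>x. of_real (x $ 2)) \<in> bh_ring a \<alpha>"
| bh_ring_cos: "(\<lambda>x. of_real (cos (x $ 3))) \<in> bh_ring a \<alpha>"
| bh_ring_inverse_rho2: "(\<lambda>x. inverse (of_real (bh_rho2 a (x $ 2) (x $ 3)))) \<in> bh_ring a \<alpha>"
| bh_ring_inverse_Omega: "(\<lambda>x. inverse (of_real (bh_Omega \<alpha> (x $ 2) (x $ 3)))) \<in> bh_ring a \<alpha>"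
| bh_ring_add: "F \<in> bh_ring a \<alpha> \<Longrightarrow> F' \<in> bh_ring a \<alpha> \<Longrightarrow> (\<lambda>x. F x + F' x) \<in> bh_ring a \<alpha>"
| bh_ring_mult: "F \<in> bh_ring a \<alpha> \<Longrightarrow> F' \<in> bh_ring a \<alpha> \<Longrightarrow> (\<lambda>x. F x * F' x) \<in> bh_ring a \<alpha>"

lemma bh_ring_uminus: "F \<in> bh_ring a \<alpha> \<Longrightarrow> (\<lambda>x. - F x) \<in> bh_ring a \<alpha>"
  using bh_ring_mult[OF bh_ring_const[of "-1"], of F] by simp

lemma bh_ring_diff: "F \<in> bh_ring a \<alpha> \<Longrightarrow> F' \<in> bh_ring a \<alpha> \<Longrightarrow> (\<lambda>x. F x - F' x) \<in> bh_ring a \<alpha>"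
  using bh_ring_add[OF _ bh_ring_uminus, of F a \<alpha> F'] by simp

lemma bh_ring_power: "F \<in> bh_ring a \<alpha> \<Longrightarrow> (\<lambda>x. F x ^ n) \<in> bh_ring a \<alpha>"
  by (induction n) (auto intro: bh_ring_const bh_ring_mult)

lemma bh_ring_sum:
  assumes "finite S" "\<And>s. s \<in> S \<Longrightarrow> F s \<in> bh_ring a \<alpha>"
  shows "(\<lambda>x. \<Sum>s\<in>S. F s x) \<in> bh_ring a \<alpha>"
  using assms by (induction rule: finite_induct) (auto intro: bh_ring_const bh_ring_add)

lemmas bh_ring_intros = bh_ring.intros bh_ring_uminus bh_ring_diff bh_ring_power bh_ring_sum finite

text \<open>Larger than \<open>bh_regular\<close>: horizons and axis may belong to it, which is what
  makes continuity at the point of the theorem available.\<close>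

definition bh_dom :: "real \<Rightarrow> real \<Rightarrow> (real^4) set" where
  "bh_dom a \<alpha> = {x. bh_rho2 a (x $ 2) (x $ 3) \<noteq> 0 \<and> bh_Omega \<alpha> (x $ 2) (x $ 3) \<noteq> 0}"

lemma bh_ring_isCont:
  assumes "F \<in> bh_ring a \<alpha>" "x \<in> bh_dom a \<alpha>"
  shows "isCont F x"
  using assms
proof (induction rule: bh_ring.induct)
  case bh_ring_inverse_rho2
  have "isCont (\<lambda>x. complex_of_real (bh_rho2 a (x $ 2) (x $ 3))) x"
    unfolding bh_rho2_def by (intro continuous_intros)
  from continuous_at_within_inverse[OF this] show ?case
    using bh_ring_inverse_rho2 by (simp add: bh_dom_def)
next
  case bh_ring_inverse_Omega
  have "isCont (\<lambda>x. complex_of_real (bh_Omega \<alpha> (x $ 2) (x $ 3))) x"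
    unfolding bh_Omega_def by (intro continuous_intros)
  from continuous_at_within_inverse[OF this] show ?case
    using bh_ring_inverse_Omega by (simp add: bh_dom_def)
qed (auto intro!: continuous_intros)

text \<open>\<open>F2\<close> and \<open>F3\<close> are the derivatives with respect to \<open>r\<close> and \<open>cos \<theta>\<close>.\<close>

definition bh_pd :: "(real^4 \<Rightarrow> complex) \<Rightarrow> (real^4 \<Rightarrow> complex) \<Rightarrow> (real^4 \<Rightarrow> complex) \<Rightarrow> real^4 \<Rightarrow> bool" where
  "bh_pd F F2 F3 x \<longleftrightarrow>
     (\<forall>i. has_pd i F (if i = 2 then F2 x else if i = 3 then - of_real (sin (x $ 3)) * F3 x else 0) x)"

lemma bh_pd_const: "bh_pd (\<lambda>_. c) (\<lambda>_. 0) (\<lambda>_. 0) x"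
  unfolding bh_pd_def using has_pd_const by auto

lemma bh_pd_add:
  assumes "bh_pd F F2 F3 x" "bh_pd G G2 G3 x"
  shows "bh_pd (\<lambda>x. F x + G x) (\<lambda>x. F2 x + G2 x) (\<lambda>x. F3 x + G3 x) x"
  unfolding bh_pd_def
proof
  fix i :: 4
  show "has_pd i (\<lambda>x. F x + G x) (if i = 2 then F2 x + G2 x
      else if i = 3 then - of_real (sin (x $ 3)) * (F3 x + G3 x) else 0) x"
    using has_pd_add[OF assms(1)[unfolded bh_pd_def, rule_format, of i] assms(2)[unfolded bh_pd_def, rule_format, of i]]
    by (auto simp: algebra_simps split: if_splits)
qed

lemma bh_pd_mult:
  assumes "bh_pd F F2 F3 x" "bh_pd G G2 G3 x"
  shows "bh_pd (\<lambda>x. F x * G x) (\<lambda>x. F2 x * G x + F x * G2 x) (\<lambda>x. F3 x * G x + F x * G3 x) x"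
  unfolding bh_pd_def
proof
  fix i :: 4
  show "has_pd i (\<lambda>x. F x * G x) (if i = 2 then F2 x * G x + F x * G2 x
      else if i = 3 then - of_real (sin (x $ 3)) * (F3 x * G x + F x * G3 x) else 0) x"
    using has_pd_mult[OF assms(1)[unfolded bh_pd_def, rule_format, of i] assms(2)[unfolded bh_pd_def, rule_format, of i]]
    by (auto simp: algebra_simps split: if_splits)
qed

lemma bh_pd_inverse:
  assumes "bh_pd F F2 F3 x" "F x \<noteq> 0"
  shows "bh_pd (\<lambda>x. inverse (F x)) (\<lambda>x. - (F2 x * (inverse (F x) * inverse (F x))))
     (\<lambda>x. - (F3 x * (inverse (F x) * inverse (F x)))) x"
  unfolding bh_pd_def
proof
  fix i :: 4
  show "has_pd i (\<lambda>x. inverse (F x)) (if i = 2 then - (F2 x * (inverse (F x) * inverse (F x)))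
      else if i = 3 then - of_real (sin (x $ 3)) * - (F3 x * (inverse (F x) * inverse (F x))) else 0) x"
    using has_pd_inverse[OF assms(1)[unfolded bh_pd_def, rule_format, of i] assms(2)]
    by (cases "i = 2"; cases "i = 3") (simp_all add: mult_ac)
qed

lemma bh_pd_r: "bh_pd (\<lambda>x. of_real (x $ 2)) (\<lambda>_. 1) (\<lambda>_. 0) x"
  unfolding bh_pd_def
proof
  fix i :: 4
  show "has_pd i (\<lambda>x. of_real (x $ 2)) (if i = 2 then 1 else if i = 3 then - of_real (sin (x $ 3)) * 0 else 0) x"
    using has_pd_of_real_component[of "\<lambda>z. z" x 2 i] by (cases "i = 2") (auto simp: analytic_on_ident)
qed

lemma bh_pd_cos: "bh_pd (\<lambda>x. of_real (cos (x $ 3))) (\<lambda>_. 0) (\<lambda>_. 1) x"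
proof -
  have "(cos :: complex \<Rightarrow> complex) analytic_on {of_real (x $ 3)}"
    by (intro analytic_intros)
  note pd = has_pd_of_real_component[OF this]
  have "has_pd i (\<lambda>x. of_real (cos (x $ 3))) (if i = 2 then 0 else if i = 3 then - of_real (sin (x $ 3)) * 1 else 0) x" for i
    using pd[of i] by (cases "i = 3") (auto simp: cos_of_real sin_of_real DERIV_imp_deriv[OF DERIV_cos])
  then show ?thesis
    unfolding bh_pd_def by simp
qed

text \<open>The ring is closed under the derivatives in r and cos \<theta>, but not in \<theta>
  itself: its elements are even in \<theta>, and differentiation in \<theta> brings in the odd
  factor sin \<theta>. \<open>bh_pd\<close> keeps this factor outside.\<close>

definition bh_differentiable :: "real \<Rightarrow> real \<Rightarrow> (real^4 \<Rightarrow> complex) \<Rightarrow> bool" where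
  "bh_differentiable a \<alpha> F \<longleftrightarrow>
     (\<exists>F2\<in>bh_ring a \<alpha>. \<exists>F3\<in>bh_ring a \<alpha>. \<forall>x\<in>bh_dom a \<alpha>. bh_pd F F2 F3 x)"

lemma bh_differentiableI:
  assumes "F2 \<in> bh_ring a \<alpha>" "F3 \<in> bh_ring a \<alpha>" "\<And>x. x \<in> bh_dom a \<alpha> \<Longrightarrow> bh_pd F F2 F3 x"
  shows "bh_differentiable a \<alpha> F"
  using assms unfolding bh_differentiable_def by blast

lemma bh_differentiable_const: "bh_differentiable a \<alpha> (\<lambda>_. c)"
  and bh_differentiable_r: "bh_differentiable a \<alpha> (\<lambda>x. of_real (x $ 2))"
  and bh_differentiable_cos: "bh_differentiable a \<alpha> (\<lambda>x. of_real (cos (x $ 3)))"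
  by (rule bh_differentiableI[OF _ _ bh_pd_const] bh_differentiableI[OF _ _ bh_pd_r]
      bh_differentiableI[OF _ _ bh_pd_cos]; rule bh_ring_const)+

lemma bh_differentiable_add:
  assumes "bh_differentiable a \<alpha> F" "bh_differentiable a \<alpha> G"
  shows "bh_differentiable a \<alpha> (\<lambda>x. F x + G x)"
proof -
  obtain F2 F3 G2 G3 where
    R: "F2 \<in> bh_ring a \<alpha>" "F3 \<in> bh_ring a \<alpha>" "G2 \<in> bh_ring a \<alpha>" "G3 \<in> bh_ring a \<alpha>"
    and pd: "\<And>x. x \<in> bh_dom a \<alpha> \<Longrightarrow> bh_pd F F2 F3 x" "\<And>x. x \<in> bh_dom a \<alpha> \<Longrightarrow> bh_pd G G2 G3 x"
    using assms unfolding bh_differentiable_def by blast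
  show ?thesis
    by (rule bh_differentiableI[OF _ _ bh_pd_add[OF pd]]) (intro bh_ring_add R)+
qed

lemma bh_differentiable_mult:
  assumes "bh_differentiable a \<alpha> F" "bh_differentiable a \<alpha> G" "F \<in> bh_ring a \<alpha>" "G \<in> bh_ring a \<alpha>"
  shows "bh_differentiable a \<alpha> (\<lambda>x. F x * G x)"
proof -
  obtain F2 F3 G2 G3 where
    R: "F2 \<in> bh_ring a \<alpha>" "F3 \<in> bh_ring a \<alpha>" "G2 \<in> bh_ring a \<alpha>" "G3 \<in> bh_ring a \<alpha>"
    and pd: "\<And>x. x \<in> bh_dom a \<alpha> \<Longrightarrow> bh_pd F F2 F3 x" "\<And>x. x \<in> bh_dom a \<alpha> \<Longrightarrow> bh_pd G G2 G3 x"
    using assms unfolding bh_differentiable_def by blast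
  show ?thesis
    by (rule bh_differentiableI[OF _ _ bh_pd_mult[OF pd]]) (intro bh_ring_add bh_ring_mult R assms)+
qed

lemma bh_differentiable_inverse:
  assumes "bh_differentiable a \<alpha> F" "(\<lambda>x. inverse (F x)) \<in> bh_ring a \<alpha>"
    "\<And>x. x \<in> bh_dom a \<alpha> \<Longrightarrow> F x \<noteq> 0"
  shows "bh_differentiable a \<alpha> (\<lambda>x. inverse (F x))"
proof -
  obtain F2 F3 where R: "F2 \<in> bh_ring a \<alpha>" "F3 \<in> bh_ring a \<alpha>"
    and pd: "\<And>x. x \<in> bh_dom a \<alpha> \<Longrightarrow> bh_pd F F2 F3 x"
    using assms(1) unfolding bh_differentiable_def by blast
  show ?thesis
    by (rule bh_differentiableI[OF _ _ bh_pd_inverse[OF pd assms(3)]])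
      (intro bh_ring_uminus bh_ring_mult R assms | assumption)+
qed

lemma bh_ring_differentiable: "F \<in> bh_ring a \<alpha> \<Longrightarrow> bh_differentiable a \<alpha> F"
proof (induction rule: bh_ring.induct)
  case bh_ring_inverse_rho2
  show ?case
  proof (rule bh_differentiable_inverse)
    have "bh_differentiable a \<alpha> (\<lambda>x. of_real (x $ 2) * of_real (x $ 2)
       + of_real (a\<^sup>2) * (of_real (cos (x $ 3)) * of_real (cos (x $ 3))))"
      by (intro bh_differentiable_add bh_differentiable_mult bh_differentiable_const
          bh_differentiable_r bh_differentiable_cos bh_ring.intros)
    then show "bh_differentiable a \<alpha> (\<lambda>x. of_real (bh_rho2 a (x $ 2) (x $ 3)))"
      by (simp add: bh_rho2_def power2_eq_square)
  qed (auto simp: bh_dom_def intro: bh_ring.intros)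
next
  case bh_ring_inverse_Omega
  show ?case
  proof (rule bh_differentiable_inverse)
    have "bh_differentiable a \<alpha> (\<lambda>x. 1 + of_real (- \<alpha>) * (of_real (x $ 2) * of_real (cos (x $ 3))))"
      by (intro bh_differentiable_add bh_differentiable_mult bh_differentiable_const
          bh_differentiable_r bh_differentiable_cos bh_ring.intros)
    then show "bh_differentiable a \<alpha> (\<lambda>x. of_real (bh_Omega \<alpha> (x $ 2) (x $ 3)))"
      by (simp add: bh_Omega_def mult.assoc)
  qed (auto simp: bh_dom_def intro: bh_ring.intros)
qed (auto intro: bh_differentiable_const bh_differentiable_r bh_differentiable_cos
      bh_differentiable_add bh_differentiable_mult)

subsection \<open>The complex Eddington--Finkelstein coframe\<close>

definition cQ :: "real \<Rightarrow> real \<Rightarrow> real \<Rightarrow> real \<Rightarrow> real \<Rightarrow> complex \<Rightarrow> complex" where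
  "cQ a m q \<Lambda> \<alpha> z = (of_real (a\<^sup>2 + q\<^sup>2) - of_real (2 * m) * z + z\<^sup>2) * (1 - of_real (\<alpha>\<^sup>2) * z\<^sup>2)
     - of_real (1/3 * \<Lambda>) * (of_real (a\<^sup>2) + z\<^sup>2) * z\<^sup>2"

definition cP :: "real \<Rightarrow> real \<Rightarrow> real \<Rightarrow> real \<Rightarrow> real \<Rightarrow> complex \<Rightarrow> complex" where
  "cP a m q \<Lambda> \<alpha> z = 1 - of_real (2 * \<alpha> * m) * cos z + of_real (\<alpha>\<^sup>2 * (a\<^sup>2 + q\<^sup>2) + 1/3 * \<Lambda> * a\<^sup>2) * (cos z)\<^sup>2"

lemma cQ_of_real: "cQ a m q \<Lambda> \<alpha> (of_real r) = of_real (bh_Q a m q \<Lambda> \<alpha> r)"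
  by (simp add: cQ_def bh_Q_def)

lemma cP_of_real: "cP a m q \<Lambda> \<alpha> (of_real t) = of_real (bh_P a m q \<Lambda> \<alpha> t)"
  by (simp add: cP_def bh_P_def cos_of_real)

text \<open>
  The differentials of the complex Eddington--Finkelstein coordinates \<open>T\<close>, \<open>r\<close>, \<open>cos \<theta>\<close>, \<open>\<Phi>\<close> with
  \<open>dT = dt + (r\<^sup>2 + a\<^sup>2)/Q dr + \<i> a sin \<theta>/P d\<theta>\<close> and \<open>d\<Phi> = d\<phi> + a/Q dr + \<i>/(P sin \<theta>) d\<theta>\<close>.
\<close>

definition bh_theta :: "real \<Rightarrow> real \<Rightarrow> real \<Rightarrow> real \<Rightarrow> real \<Rightarrow> 4 \<Rightarrow> 4 \<Rightarrow> complex \<Rightarrow> complex" where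
  "bh_theta a m q \<Lambda> \<alpha> b i z = (vector [
     vector [1, (z\<^sup>2 + of_real (a\<^sup>2)) / cQ a m q \<Lambda> \<alpha> z, \<i> * of_real a * sin z / cP a m q \<Lambda> \<alpha> z, 0],
     vector [0, 1, 0, 0],
     vector [0, 0, - sin z, 0],
     vector [0, of_real a / cQ a m q \<Lambda> \<alpha> z, \<i> / (cP a m q \<Lambda> \<alpha> z * sin z), 1]] :: complex^4^4) $ b $ i"

text \<open>The inverse of \<open>bh_theta\<close>. The first and last columns of
  \<open>bh_theta\<close> are constant, so column \<open>b\<close> of the inverse again depends on
  coordinate \<open>b\<close> alone, as the locale demands.\<close>

definition bh_frame :: "real \<Rightarrow> real \<Rightarrow> real \<Rightarrow> real \<Rightarrow> real \<Rightarrow> 4 \<Rightarrow> 4 \<Rightarrow> complex \<Rightarrow> complex" where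
  "bh_frame a m q \<Lambda> \<alpha> i b z = (vector [
     vector [1, - ((z\<^sup>2 + of_real (a\<^sup>2)) / cQ a m q \<Lambda> \<alpha> z), \<i> * of_real a / cP a m q \<Lambda> \<alpha> z, 0],
     vector [0, 1, 0, 0],
     vector [0, 0, - (1 / sin z), 0],
     vector [0, - (of_real a / cQ a m q \<Lambda> \<alpha> z), \<i> / (cP a m q \<Lambda> \<alpha> z * (sin z)\<^sup>2), 1]] :: complex^4^4) $ i $ b"

text \<open>
  In terms of \<open>U = dT - a sin\<^sup>2 \<theta> d\<Phi>\<close> and \<open>V = a dT - (r\<^sup>2 + a\<^sup>2) d\<Phi>\<close> the metric is
  \<open>\<Omega>\<^sup>-\<^sup>2 (- Q/\<rho>\<^sup>2 U\<^sup>2 + 2 U dr + P sin\<^sup>2 \<theta>/\<rho>\<^sup>2 V\<^sup>2 - 2 \<i> V d(cos \<theta>))\<close>.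
\<close>

definition bh_UV :: "real \<Rightarrow> real^4 \<Rightarrow> complex^4^4" where
  "bh_UV a x = (let r = of_real (x $ 2); c = of_real (cos (x $ 3)) in vector [
     vector [1, 0, 0, - (of_real a * (1 - c\<^sup>2))],
     vector [0, 1, 0, 0],
     vector [0, 0, 1, 0],
     vector [of_real a, 0, 0, - (r\<^sup>2 + of_real (a\<^sup>2))]])"

text \<open>The block of \<open>bh_UV\<close> that mixes dT and d\<Phi> has determinant -\<rho>^2;
  this is why the reciprocal of \<rho>^2 is a generator of \<open>bh_ring\<close>.\<close>

definition bh_UV_inv :: "real \<Rightarrow> real^4 \<Rightarrow> complex^4^4" where
  "bh_UV_inv a x = (let r = of_real (x $ 2); c = of_real (cos (x $ 3));
       n = inverse (of_real (bh_rho2 a (x $ 2) (x $ 3))) in vector [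
     vector [(r\<^sup>2 + of_real (a\<^sup>2)) * n, 0, 0, - (of_real a * (1 - c\<^sup>2) * n)],
     vector [0, 1, 0, 0],
     vector [0, 0, 1, 0],
     vector [of_real a * n, 0, 0, - n]])"

text \<open>P sin^2 \<theta> as a polynomial in cos \<theta>. It is to cos \<theta> what Q is to r,
  the axis corresponding to the horizons.\<close>

definition bh_S :: "real \<Rightarrow> real \<Rightarrow> real \<Rightarrow> real \<Rightarrow> real \<Rightarrow> real^4 \<Rightarrow> complex" where
  "bh_S a m q \<Lambda> \<alpha> x = (let c = of_real (cos (x $ 3)) in
     (1 - of_real (2 * \<alpha> * m) * c + of_real (\<alpha>\<^sup>2 * (a\<^sup>2 + q\<^sup>2) + 1/3 * \<Lambda> * a\<^sup>2) * c\<^sup>2) * (1 - c\<^sup>2))"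

text \<open>The Gram matrix of the metric for U, dr, d(cos \<theta>), V. In each block Q or
  \<open>bh_S\<close> occupies one diagonal entry opposite a zero, so the determinants -w^2 and w^2
  do not involve them and the inverse acquires no pole at a horizon or on the axis.\<close>

definition bh_N :: "real \<Rightarrow> real \<Rightarrow> real \<Rightarrow> real \<Rightarrow> real \<Rightarrow> real^4 \<Rightarrow> complex^4^4" where
  "bh_N a m q \<Lambda> \<alpha> x = (let n = inverse (of_real (bh_rho2 a (x $ 2) (x $ 3)));
       w = (inverse (of_real (bh_Omega \<alpha> (x $ 2) (x $ 3))))\<^sup>2 in vector [
     vector [- (cQ a m q \<Lambda> \<alpha> (of_real (x $ 2)) * n * w), w, 0, 0],
     vector [w, 0, 0, 0],
     vector [0, 0, 0, - (\<i> * w)],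
     vector [0, 0, - (\<i> * w), bh_S a m q \<Lambda> \<alpha> x * n * w]])"

definition bh_N_inv :: "real \<Rightarrow> real \<Rightarrow> real \<Rightarrow> real \<Rightarrow> real \<Rightarrow> real^4 \<Rightarrow> complex^4^4" where
  "bh_N_inv a m q \<Lambda> \<alpha> x = (let n = inverse (of_real (bh_rho2 a (x $ 2) (x $ 3)));
       w = (1 - of_real \<alpha> * of_real (x $ 2) * of_real (cos (x $ 3)))\<^sup>2 in vector [
     vector [0, w, 0, 0],
     vector [w, cQ a m q \<Lambda> \<alpha> (of_real (x $ 2)) * n * w, 0, 0],
     vector [0, 0, bh_S a m q \<Lambda> \<alpha> x * n * w, \<i> * w],
     vector [0, 0, \<i> * w, 0]])"

definition bh_h :: "real \<Rightarrow> real \<Rightarrow> real \<Rightarrow> real \<Rightarrow> real \<Rightarrow> 4 \<Rightarrow> 4 \<Rightarrow> real^4 \<Rightarrow> complex" where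
  "bh_h a m q \<Lambda> \<alpha> i j x = (transpose (bh_UV a x) ** bh_N a m q \<Lambda> \<alpha> x ** bh_UV a x) $ i $ j"

definition bh_K :: "real \<Rightarrow> real \<Rightarrow> real \<Rightarrow> real \<Rightarrow> real \<Rightarrow> 4 \<Rightarrow> 4 \<Rightarrow> real^4 \<Rightarrow> complex" where
  "bh_K a m q \<Lambda> \<alpha> i j x =
     (bh_UV_inv a x ** bh_N_inv a m q \<Lambda> \<alpha> x ** transpose (bh_UV_inv a x)) $ i $ j"

section \<open>Regularity, inverses and determinants of the black hole coframe data\<close>

lemma matrix_mult_ring:
  assumes "\<And>i j. (\<lambda>x. A x $ i $ j) \<in> bh_ring a \<alpha>" "\<And>i j. (\<lambda>x. B x $ i $ j) \<in> bh_ring a \<alpha>"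
  shows "(\<lambda>x. (A x ** B x :: complex^'n^'m) $ i $ j) \<in> bh_ring a \<alpha>"
  unfolding matrix_matrix_mult_def vec_lambda_beta by (intro bh_ring_intros assms)

lemma bh_UV_ring: "(\<lambda>x. bh_UV a x $ i $ j) \<in> bh_ring a \<alpha>"
  using exhaust_4[of i] exhaust_4[of j]
  by (elim disjE; simp add: bh_UV_def Let_def; intro bh_ring_intros)

lemma bh_UV_inv_ring: "(\<lambda>x. bh_UV_inv a x $ i $ j) \<in> bh_ring a \<alpha>"
  using exhaust_4[of i] exhaust_4[of j]
  by (elim disjE; simp add: bh_UV_inv_def Let_def; intro bh_ring_intros)

lemma bh_S_ring: "bh_S a m q \<Lambda> \<alpha> \<in> bh_ring a \<alpha>"
  unfolding bh_S_def[abs_def] Let_def by (intro bh_ring_intros)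

lemma cQ_ring: "(\<lambda>x. cQ a m q \<Lambda> \<alpha> (of_real (x $ 2))) \<in> bh_ring a \<alpha>"
  unfolding cQ_def by (intro bh_ring_intros)

lemma bh_N_ring: "(\<lambda>x. bh_N a m q \<Lambda> \<alpha> x $ i $ j) \<in> bh_ring a \<alpha>"
  using exhaust_4[of i] exhaust_4[of j]
  by (elim disjE; simp add: bh_N_def Let_def del: of_real_power; intro bh_ring_intros bh_S_ring cQ_ring)

lemma bh_N_inv_ring: "(\<lambda>x. bh_N_inv a m q \<Lambda> \<alpha> x $ i $ j) \<in> bh_ring a \<alpha>"
  using exhaust_4[of i] exhaust_4[of j]
  by (elim disjE; simp add: bh_N_inv_def Let_def; intro bh_ring_intros bh_S_ring cQ_ring)

lemma transpose_nth: "transpose A $ i $ j = A $ j $ i"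
  by (simp add: transpose_def)

lemma bh_h_ring: "bh_h a m q \<Lambda> \<alpha> i j \<in> bh_ring a \<alpha>"
  unfolding bh_h_def[abs_def]
  by (intro matrix_mult_ring bh_UV_ring bh_N_ring) (simp add: transpose_nth bh_UV_ring)

lemma bh_K_ring: "bh_K a m q \<Lambda> \<alpha> i j \<in> bh_ring a \<alpha>"
  unfolding bh_K_def[abs_def]
  by (intro matrix_mult_ring bh_UV_inv_ring bh_N_inv_ring) (simp add: transpose_nth bh_UV_inv_ring)

lemma matrix_eq_4: "(A :: 'a^4^4) = B \<longleftrightarrow> (\<forall>i\<in>{1,2,3,4}. \<forall>j\<in>{1,2,3,4}. A $ i $ j = B $ i $ j)"
  by (simp add: vec_eq_iff forall_4)

lemma bh_UV_inverse:
  assumes "bh_rho2 a (x $ 2) (x $ 3) \<noteq> 0"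
  shows "bh_UV a x ** bh_UV_inv a x = mat 1"
proof -
  define n r c A where "n = inverse (complex_of_real (bh_rho2 a (x $ 2) (x $ 3)))"
    and "r = complex_of_real (x $ 2)" and "c = complex_of_real (cos (x $ 3))" and "A = complex_of_real a"
  have "complex_of_real (bh_rho2 a (x $ 2) (x $ 3)) = r\<^sup>2 + A\<^sup>2 * c\<^sup>2"
    by (simp add: bh_rho2_def r_def c_def A_def)
  moreover have "complex_of_real (bh_rho2 a (x $ 2) (x $ 3)) \<noteq> 0"
    using assms by simp
  ultimately have n: "n * (r\<^sup>2 + A\<^sup>2 * c\<^sup>2) = 1"
    by (simp add: n_def)
  have "(r\<^sup>2 + A\<^sup>2) * n - A * ((1 - c\<^sup>2) * (A * n)) = 1"
    using n by algebra
  moreover have "A * ((r\<^sup>2 + A\<^sup>2) * n) + (- r\<^sup>2 - A\<^sup>2) * (A * n) = 0"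
    by (simp add: algebra_simps)
  moreover have "- (A * (A * ((1 - c\<^sup>2) * n))) - (- r\<^sup>2 - A\<^sup>2) * n = 1"
    using n by algebra
  ultimately show ?thesis
    unfolding matrix_eq_4 matrix_matrix_mult_def
    by (simp add: sum_4 bh_UV_def bh_UV_inv_def Let_def mat_def mult.assoc
        flip: n_def r_def c_def A_def)
qed

lemma bh_N_inverse:
  assumes "bh_Omega \<alpha> (x $ 2) (x $ 3) \<noteq> 0"
  shows "bh_N_inv a m q \<Lambda> \<alpha> x ** bh_N a m q \<Lambda> \<alpha> x = mat 1"
proof -
  have O: "1 - complex_of_real \<alpha> * of_real (x $ 2) * of_real (cos (x $ 3)) = of_real (bh_Omega \<alpha> (x $ 2) (x $ 3))"
    by (simp add: bh_Omega_def)
  have "complex_of_real (bh_Omega \<alpha> (x $ 2) (x $ 3)) \<noteq> 0"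
    using assms by simp
  then show ?thesis
    unfolding matrix_eq_4 matrix_matrix_mult_def
    by (simp add: sum_4 bh_N_def bh_N_inv_def Let_def mat_def O)
       (simp add: field_simps power2_eq_square)
qed

lemma bh_K_h:
  assumes "x \<in> bh_regular a m q \<Lambda> \<alpha>"
  shows "(\<chi> i j. bh_K a m q \<Lambda> \<alpha> i j x) ** (\<chi> i j. bh_h a m q \<Lambda> \<alpha> i j x) = mat 1"
proof -
  let ?M = "bh_UV a x" and ?W = "bh_UV_inv a x" and ?N = "bh_N a m q \<Lambda> \<alpha> x" and ?L = "bh_N_inv a m q \<Lambda> \<alpha> x"
  have MW: "?M ** ?W = mat 1" and LN: "?L ** ?N = mat 1"
    using assms bh_UV_inverse bh_N_inverse by (auto simp: bh_regular_def)
  have WM: "?W ** ?M = mat 1"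
    using MW matrix_left_right_inverse by blast
  have WMt: "transpose ?W ** transpose ?M = mat 1"
    unfolding matrix_transpose_mul[symmetric] MW by simp
  have "(?W ** ?L ** transpose ?W) ** (transpose ?M ** ?N ** ?M) =
     ?W ** (?L ** ((transpose ?W ** transpose ?M) ** ?N)) ** ?M"
    by (simp add: matrix_mul_assoc)
  also have "\<dots> = mat 1"
    unfolding WMt by (simp add: LN WM)
  finally show ?thesis
    by (simp add: bh_K_def bh_h_def vec_lambda_eta)
qed

lemma bh_theta_frame:
  assumes "x \<in> bh_regular a m q \<Lambda> \<alpha>"
  shows "(\<chi> b i. bh_theta a m q \<Lambda> \<alpha> b i (of_real (x $ i))) **
    (\<chi> i b. bh_frame a m q \<Lambda> \<alpha> i b (of_real (x $ b))) = mat 1"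
proof -
  have "sin (complex_of_real (x $ 3)) \<noteq> 0"
    using assms sin_gt_zero[of "x $ 3"] by (auto simp: bh_regular_def sin_of_real)
  then show ?thesis
    unfolding matrix_eq_4 matrix_matrix_mult_def
    by (simp add: sum_4 bh_theta_def bh_frame_def mat_def)
       (simp add: field_simps power2_eq_square)
qed

lemma bh_S_eq: "bh_S a m q \<Lambda> \<alpha> x = of_real (bh_P a m q \<Lambda> \<alpha> (x $ 3)) * (of_real (sin (x $ 3)))\<^sup>2"
proof -
  have "1 - (complex_of_real (cos (x $ 3)))\<^sup>2 = (of_real (sin (x $ 3)))\<^sup>2"
    unfolding of_real_power[symmetric] sin_squared_eq by simp
  then show ?thesis
    by (simp add: bh_S_def Let_def bh_P_def)
qed

lemma bh_regularD:
  assumes "x \<in> bh_regular a m q \<Lambda> \<alpha>"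
  shows "sin (x $ 3) > 0" "bh_Omega \<alpha> (x $ 2) (x $ 3) > 0" "bh_rho2 a (x $ 2) (x $ 3) > 0"
    "bh_P a m q \<Lambda> \<alpha> (x $ 3) > 0" "bh_Q a m q \<Lambda> \<alpha> (x $ 2) \<noteq> 0"
proof -
  have "bh_rho2 a (x $ 2) (x $ 3) \<ge> 0"
    by (simp add: bh_rho2_def)
  then show "bh_rho2 a (x $ 2) (x $ 3) > 0"
    using assms by (simp add: bh_regular_def)
qed (use assms sin_gt_zero in \<open>auto simp: bh_regular_def\<close>)

text \<open>This cancellation dictates the shifts in dT and d\<Phi>. In U the d\<theta> parts cancel
  and the dr parts add up to \<rho>^2/Q because r^2 + a^2 - a^2 sin^2 \<theta> = \<rho>^2; in V the
  dr parts cancel and the same identity yields the d\<theta> part.\<close>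

lemma bh_UV_theta:
  assumes "x \<in> bh_regular a m q \<Lambda> \<alpha>"
  defines "R \<equiv> complex_of_real (bh_rho2 a (x $ 2) (x $ 3))" and "s \<equiv> complex_of_real (sin (x $ 3))"
    and "Q \<equiv> complex_of_real (bh_Q a m q \<Lambda> \<alpha> (x $ 2))" and "P \<equiv> complex_of_real (bh_P a m q \<Lambda> \<alpha> (x $ 3))"
  shows "bh_UV a x ** (\<chi> b i. bh_theta a m q \<Lambda> \<alpha> b i (of_real (x $ i))) = vector [
     vector [1, R / Q, 0, - (of_real a * s\<^sup>2)],
     vector [0, 1, 0, 0],
     vector [0, 0, - s, 0],
     vector [of_real a, 0, - (\<i> * R / (P * s)), - ((of_real (x $ 2))\<^sup>2 + (of_real a)\<^sup>2)]]"
proof -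
  define r c A where "r = complex_of_real (x $ 2)" and "c = complex_of_real (cos (x $ 3))" and "A = complex_of_real a"
  have s: "1 - c\<^sup>2 = s\<^sup>2"
    unfolding c_def s_def of_real_power[symmetric] sin_squared_eq by simp
  have R: "R = r\<^sup>2 + A\<^sup>2 * (1 - s\<^sup>2)"
    unfolding s[symmetric] by (simp add: R_def bh_rho2_def r_def c_def A_def)
  have nz: "s \<noteq> 0" "Q \<noteq> 0" "P \<noteq> 0"
    using bh_regularD[OF assms(1)] by (auto simp: s_def Q_def P_def)
  have cQ: "cQ a m q \<Lambda> \<alpha> r = Q" and cP: "cP a m q \<Lambda> \<alpha> (of_real (x $ 3)) = P"
    and sin: "sin (of_real (x $ 3)) = s"
    by (simp_all add: cQ_of_real cP_of_real sin_of_real r_def Q_def P_def s_def)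
  show ?thesis
    unfolding matrix_eq_4 matrix_matrix_mult_def
    by (simp add: sum_4 bh_UV_def bh_theta_def Let_def cQ cP sin s flip: r_def c_def A_def)
       (simp add: R nz field_simps power2_eq_square)
qed

text \<open>Undoing the completed squares: the mixed terms 2 U dr and - 2 i V d(cos \<theta>) remove
  the cross terms of U^2 and V^2 and turn the leftover - (\<rho>^2/Q) dr^2 and - (\<rho>^2/P)
  d\<theta>^2 into their negatives, the diagonal terms of the metric.\<close>

lemma bh_metric_UV:
  assumes "x \<in> bh_regular a m q \<Lambda> \<alpha>"
  defines "M \<equiv> bh_UV a x ** (\<chi> b i. bh_theta a m q \<Lambda> \<alpha> b i (of_real (x $ i)))"
  shows "cmat (bh_metric a m q \<Lambda> \<alpha> x) = transpose M ** bh_N a m q \<Lambda> \<alpha> x ** M"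
proof -
  define R s Q P W r A
    where "R = complex_of_real (bh_rho2 a (x $ 2) (x $ 3))" and "s = complex_of_real (sin (x $ 3))"
    and "Q = complex_of_real (bh_Q a m q \<Lambda> \<alpha> (x $ 2))" and "P = complex_of_real (bh_P a m q \<Lambda> \<alpha> (x $ 3))"
    and "W = complex_of_real (bh_Omega \<alpha> (x $ 2) (x $ 3))"
    and "r = complex_of_real (x $ 2)" and "A = complex_of_real a"
  have nz: "s \<noteq> 0" "Q \<noteq> 0" "P \<noteq> 0" "R \<noteq> 0" "W \<noteq> 0"
    using bh_regularD[OF assms(1)] by (auto simp: s_def Q_def P_def R_def W_def)
  have M: "M = vector [vector [1, R / Q, 0, - (A * s\<^sup>2)], vector [0, 1, 0, 0], vector [0, 0, - s, 0],
      vector [A, 0, - (\<i> * R / (P * s)), - (r\<^sup>2 + A\<^sup>2)]]"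
    unfolding M_def bh_UV_theta[OF assms(1)] R_def s_def Q_def P_def r_def A_def ..
  have N: "bh_N a m q \<Lambda> \<alpha> x = vector [vector [- (Q / (R * W\<^sup>2)), 1 / W\<^sup>2, 0, 0], vector [1 / W\<^sup>2, 0, 0, 0],
      vector [0, 0, 0, - (\<i> / W\<^sup>2)], vector [0, 0, - (\<i> / W\<^sup>2), P * s\<^sup>2 / (R * W\<^sup>2)]]"
    unfolding matrix_eq_4
    by (simp add: bh_N_def Let_def bh_S_eq cQ_of_real divide_inverse mult_ac power_inverse flip: R_def s_def Q_def P_def W_def)
  have G: "cmat (bh_metric a m q \<Lambda> \<alpha> x) $ i $ j = 1 / W\<^sup>2 * (- (Q / R) * ((if i = 1 then 1 else if i = 4 then - (A * s\<^sup>2) else 0) * (if j = 1 then 1 else if j = 4 then - (A * s\<^sup>2) else 0))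
     + R / Q * ((if i = 2 then 1 else 0) * (if j = 2 then 1 else 0))
     + R / P * ((if i = 3 then 1 else 0) * (if j = 3 then 1 else 0))
     + P / R * s\<^sup>2 * ((if i = 1 then A else if i = 4 then - (r\<^sup>2 + A\<^sup>2) else 0) * (if j = 1 then A else if j = 4 then - (r\<^sup>2 + A\<^sup>2) else 0)))" for i j
    using exhaust_4[of i] exhaust_4[of j]
    by (elim disjE) (simp_all add: cmat_def bh_metric_def Let_def axis_def R_def s_def Q_def P_def W_def r_def A_def)
  show ?thesis
    unfolding matrix_eq_4 G unfolding M N matrix_matrix_mult_def
    by (simp add: sum_4 transpose_def)
       (simp add: nz field_simps power2_eq_square)
qed

lemma det_bh_UV: "det (bh_UV a x) = - of_real (bh_rho2 a (x $ 2) (x $ 3))"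
  by (simp add: det_4 bh_UV_def Let_def bh_rho2_def) (simp add: algebra_simps power2_eq_square)

lemma det_bh_N: "det (bh_N a m q \<Lambda> \<alpha> x) = - (inverse (of_real (bh_Omega \<alpha> (x $ 2) (x $ 3))) ^ 8)"
proof -
  have i: "\<i> * z * (\<i> * z) = - (z * z)" for z :: complex by (simp add: algebra_simps)
  show ?thesis
    by (simp add: det_4 bh_N_def Let_def i)
qed

lemma det_bh_theta:
  "det (\<chi> b i. bh_theta a m q \<Lambda> \<alpha> b i (of_real (x $ i)) :: complex^4^4) = - of_real (sin (x $ 3))"
  by (simp add: det_4 bh_theta_def sin_of_real)

lemma det_bh_metric:
  assumes "x \<in> bh_regular a m q \<Lambda> \<alpha>"
  shows "det (bh_metric a m q \<Lambda> \<alpha> x) =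
    - (sin (x $ 3) * bh_rho2 a (x $ 2) (x $ 3) / bh_Omega \<alpha> (x $ 2) (x $ 3) ^ 4)\<^sup>2"
proof -
  have "complex_of_real (det (bh_metric a m q \<Lambda> \<alpha> x)) =
    of_real (- (sin (x $ 3) * bh_rho2 a (x $ 2) (x $ 3) / bh_Omega \<alpha> (x $ 2) (x $ 3) ^ 4)\<^sup>2)"
    unfolding det_cmat[symmetric] bh_metric_UV[OF assms] det_mul det_transpose det_bh_UV det_bh_N det_bh_theta
    by (simp add: field_simps power2_eq_square)
  then show ?thesis by (simp only: of_real_eq_iff)
qed

lemma open_bh_regular: "open (bh_regular a m q \<Lambda> \<alpha>)"
  unfolding bh_regular_def bh_Omega_def bh_rho2_def bh_P_def bh_Q_def
  by (intro open_Collect_conj open_Collect_less open_Collect_neq continuous_intros)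

lemma bh_regular_subset_dom: "bh_regular a m q \<Lambda> \<alpha> \<subseteq> bh_dom a \<alpha>"
  by (auto simp: bh_regular_def bh_dom_def)

lemma bh_coframe_analytic:
  assumes "x \<in> bh_regular a m q \<Lambda> \<alpha>"
  shows "bh_theta a m q \<Lambda> \<alpha> b i analytic_on {of_real (x $ i)}"
    and "bh_frame a m q \<Lambda> \<alpha> i b analytic_on {of_real (x $ b)}"
proof -
  have nz: "cQ a m q \<Lambda> \<alpha> (of_real (x $ 2)) \<noteq> 0" "cP a m q \<Lambda> \<alpha> (of_real (x $ 3)) \<noteq> 0"
    "sin (complex_of_real (x $ 3)) \<noteq> 0"
    using bh_regularD[OF assms] by (auto simp: cQ_of_real cP_of_real sin_of_real)
  have an: "cQ a m q \<Lambda> \<alpha> analytic_on S" "cP a m q \<Lambda> \<alpha> analytic_on S" for S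
    unfolding cQ_def[abs_def] cP_def[abs_def] by (intro analytic_intros)+
  show "bh_theta a m q \<Lambda> \<alpha> b i analytic_on {of_real (x $ i)}"
    using exhaust_4[of b] exhaust_4[of i] nz
    by (elim disjE; simp add: bh_theta_def[abs_def]; intro analytic_intros an; simp)
  show "bh_frame a m q \<Lambda> \<alpha> i b analytic_on {of_real (x $ b)}"
    using exhaust_4[of b] exhaust_4[of i] nz
    by (elim disjE; simp add: bh_frame_def[abs_def]; intro analytic_intros an; simp)
qed

lemma bh_ring_pd:
  assumes "F \<in> bh_ring a \<alpha>"
  shows "\<exists>F'. (\<forall>b. F' b \<in> bh_ring a \<alpha>) \<and> (\<forall>x\<in>bh_regular a m q \<Lambda> \<alpha>. \<forall>i.
     has_pd i F (\<Sum>b\<in>UNIV. bh_theta a m q \<Lambda> \<alpha> b i (of_real (x $ i)) * F' b x) x)"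
proof -
  obtain F2 F3 where R: "F2 \<in> bh_ring a \<alpha>" "F3 \<in> bh_ring a \<alpha>"
    and pd: "\<And>x. x \<in> bh_dom a \<alpha> \<Longrightarrow> bh_pd F F2 F3 x"
    using bh_ring_differentiable[OF assms] unfolding bh_differentiable_def by blast
  \<comment> \<open>The differential of a ring element is \<open>F2\<close> dr + \<open>F3\<close>
    d(cos \<theta>), a combination of the second and third covectors of the coframe.\<close>
  define F' where "F' b = (if b = 2 then F2 else if b = 3 then F3 else (\<lambda>_. 0))" for b :: 4
  have "F' b \<in> bh_ring a \<alpha>" for b
    unfolding F'_def using R bh_ring_const by simp
  moreover have "has_pd i F (\<Sum>b\<in>UNIV. bh_theta a m q \<Lambda> \<alpha> b i (of_real (x $ i)) * F' b x) x"
    if "x \<in> bh_regular a m q \<Lambda> \<alpha>" for x i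
  proof -
    have "has_pd i F (if i = 2 then F2 x else if i = 3 then - of_real (sin (x $ 3)) * F3 x else 0) x"
      using pd that bh_regular_subset_dom unfolding bh_pd_def by blast
    moreover have "(\<Sum>b\<in>UNIV. bh_theta a m q \<Lambda> \<alpha> b i (of_real (x $ i)) * F' b x) =
      (if i = 2 then F2 x else if i = 3 then - of_real (sin (x $ 3)) * F3 x else 0)"
      using exhaust_4[of i] by (elim disjE) (simp_all add: sum_4 bh_theta_def F'_def sin_of_real)
    ultimately show ?thesis by simp
  qed
  ultimately show ?thesis by blast
qed

lemma bh_h_sym: "bh_h a m q \<Lambda> \<alpha> i j = bh_h a m q \<Lambda> \<alpha> j i"
proof -
  have "transpose (bh_N a m q \<Lambda> \<alpha> x) = bh_N a m q \<Lambda> \<alpha> x" for x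
    unfolding matrix_eq_4 by (simp add: transpose_def bh_N_def Let_def)
  then have sym: "transpose (transpose (bh_UV a x) ** bh_N a m q \<Lambda> \<alpha> x ** bh_UV a x) =
      transpose (bh_UV a x) ** bh_N a m q \<Lambda> \<alpha> x ** bh_UV a x" for x
    by (simp add: matrix_transpose_mul matrix_mul_assoc)
  show ?thesis
    unfolding bh_h_def fun_eq_iff by (subst sym[symmetric]) (simp only: transpose_nth, rule allI, rule refl)
qed

interpretation bh: complex_coframe4 "bh_metric a m q \<Lambda> \<alpha>" "bh_regular a m q \<Lambda> \<alpha>" "bh_ring a \<alpha>"
  "bh_theta a m q \<Lambda> \<alpha>" "bh_frame a m q \<Lambda> \<alpha>" "bh_h a m q \<Lambda> \<alpha>" "bh_K a m q \<Lambda> \<alpha>"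
proof (unfold_locales, goal_cases)
  \<comment> \<open>The ninth goal is the locale axiom \<open>metric\<close>.\<close>
  case (9 x i j)
  let ?T = "\<chi> b i. bh_theta a m q \<Lambda> \<alpha> b i (of_real (x $ i)) :: complex^4^4"
  let ?H = "\<chi> i j. bh_h a m q \<Lambda> \<alpha> i j x"
  have "cmat (bh_metric a m q \<Lambda> \<alpha> x) = transpose ?T ** ?H ** ?T"
    unfolding bh_metric_UV[OF 9] by (simp add: matrix_transpose_mul matrix_mul_assoc bh_h_def vec_lambda_eta)
  then have "cmat (bh_metric a m q \<Lambda> \<alpha> x) $ i $ j = (transpose ?T ** ?H ** ?T) $ i $ j"
    by simp
  then have "complex_of_real (bh_metric a m q \<Lambda> \<alpha> x $ i $ j) =
    (\<Sum>c\<in>UNIV. \<Sum>b\<in>UNIV. ?T $ b $ i * ?T $ c $ j * ?H $ b $ c)"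
    unfolding matrix_matrix_mult_def cmat_def transpose_def vec_lambda_beta sum_distrib_right
    by (simp add: mult_ac)
  then show ?case
    by (subst sum.swap) simp
qed (intro open_bh_regular bh_ring_intros bh_ring_pd bh_h_ring bh_K_ring bh_h_sym bh_K_h bh_theta_frame bh_coframe_analytic; assumption)+

text \<open>For \<open>I2\<close> the square root of the determinant contributes sin \<theta>
  \<rho>^2/\<Omega>^4 and the dual frame contributes -1/sin \<theta>. The pole on the axis cancels,
  and the remaining factor lies in the ring.\<close>

lemma bh_invariants:
  obtains F1 F2 where "F1 \<in> bh_ring a \<alpha>" "F2 \<in> bh_ring a \<alpha>"
    "\<And>x. x \<in> bh_regular a m q \<Lambda> \<alpha> \<Longrightarrow> of_real (I1 (bh_metric a m q \<Lambda> \<alpha>) x) = F1 x"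
    "\<And>x. x \<in> bh_regular a m q \<Lambda> \<alpha> \<Longrightarrow> of_real (I2 (bh_metric a m q \<Lambda> \<alpha>) x) = F2 x"
proof
  let ?J = "\<lambda>x. - (of_real (bh_rho2 a (x $ 2) (x $ 3)) * (inverse (of_real (bh_Omega \<alpha> (x $ 2) (x $ 3)))) ^ 4)
     * bh.dual_contraction a m q \<Lambda> \<alpha> x"
  show "bh.contraction a m q \<Lambda> \<alpha> \<in> bh_ring a \<alpha>" by (rule bh.contraction_R)
  show "of_real (I1 (bh_metric a m q \<Lambda> \<alpha>) x) = bh.contraction a m q \<Lambda> \<alpha> x"
    if "x \<in> bh_regular a m q \<Lambda> \<alpha>" for x
    by (rule bh.I1_coframe[OF that])
  have "(\<lambda>x. complex_of_real (bh_rho2 a (x $ 2) (x $ 3))) \<in> bh_ring a \<alpha>"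
    unfolding bh_rho2_def by (simp, intro bh_ring_intros)
  then show "?J \<in> bh_ring a \<alpha>"
    by (intro bh_ring_intros bh.dual_contraction_R)
  show "of_real (I2 (bh_metric a m q \<Lambda> \<alpha>) x) = ?J x" if x: "x \<in> bh_regular a m q \<Lambda> \<alpha>" for x
  proof -
    note pos = bh_regularD[OF x]
    have "det (bh.E a m q \<Lambda> \<alpha> x) * det (bh.\<Theta> a m q \<Lambda> \<alpha> x) = 1"
      unfolding det_mul[symmetric] bh.E_\<Theta>[OF x] by simp
    moreover have "det (bh.\<Theta> a m q \<Lambda> \<alpha> x) = - of_real (sin (x $ 3))"
      unfolding bh.\<Theta>_def bh.Th_def by (rule det_bh_theta)
    ultimately have E: "det (bh.E a m q \<Lambda> \<alpha> x) = - inverse (of_real (sin (x $ 3)))"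
      using pos(1) by (simp add: field_simps minus_equation_iff)
    have s: "sqrt \<bar>det (bh_metric a m q \<Lambda> \<alpha> x)\<bar> =
      sin (x $ 3) * bh_rho2 a (x $ 2) (x $ 3) / bh_Omega \<alpha> (x $ 2) (x $ 3) ^ 4"
      unfolding det_bh_metric[OF x] using pos by simp
    show ?thesis
      unfolding bh.I2_coframe[OF x] E s using pos by (simp add: field_simps)
  qed
qed

lemma bh_ginv:
  assumes "x \<in> bh_regular a m q \<Lambda> \<alpha>"
  shows "ginv (bh_metric a m q \<Lambda> \<alpha>) x $ 2 $ 2 =
      (bh_Omega \<alpha> (x $ 2) (x $ 3))\<^sup>2 * bh_Q a m q \<Lambda> \<alpha> (x $ 2) / bh_rho2 a (x $ 2) (x $ 3)"
    and "ginv (bh_metric a m q \<Lambda> \<alpha>) x $ 3 $ 3 =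
      (bh_Omega \<alpha> (x $ 2) (x $ 3))\<^sup>2 * bh_P a m q \<Lambda> \<alpha> (x $ 3) / bh_rho2 a (x $ 2) (x $ 3)"
    and "ginv (bh_metric a m q \<Lambda> \<alpha>) x $ 2 $ 3 = 0"
    and "ginv (bh_metric a m q \<Lambda> \<alpha>) x $ 3 $ 2 = 0"
proof -
  note pos = bh_regularD[OF assms]
  let ?g = "ginv (bh_metric a m q \<Lambda> \<alpha>) x"
  have O: "1 - complex_of_real \<alpha> * of_real (x $ 2) * of_real (cos (x $ 3)) = of_real (bh_Omega \<alpha> (x $ 2) (x $ 3))"
    by (simp add: bh_Omega_def)
  have "of_real (?g $ i $ j) = (bh.E a m q \<Lambda> \<alpha> x ** bh.Km a m q \<Lambda> \<alpha> x ** transpose (bh.E a m q \<Lambda> \<alpha> x)) $ i $ j" for i j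
    unfolding bh.cmat_ginv[OF assms, symmetric] by (simp add: cmat_def)
  note g = this[unfolded matrix_matrix_mult_def bh.E_def bh.Ev_def bh.Km_def bh_K_def]
  have "complex_of_real (?g $ 2 $ 2) = of_real ((bh_Omega \<alpha> (x $ 2) (x $ 3))\<^sup>2 * bh_Q a m q \<Lambda> \<alpha> (x $ 2) / bh_rho2 a (x $ 2) (x $ 3))"
    "complex_of_real (?g $ 3 $ 3) = of_real ((bh_Omega \<alpha> (x $ 2) (x $ 3))\<^sup>2 * bh_P a m q \<Lambda> \<alpha> (x $ 3) / bh_rho2 a (x $ 2) (x $ 3))"
    "complex_of_real (?g $ 2 $ 3) = of_real 0" "complex_of_real (?g $ 3 $ 2) = of_real 0"
    using pos unfolding g
    by (simp_all add: sum_4 transpose_def bh_frame_def matrix_matrix_mult_def bh_UV_inv_def bh_N_inv_def Let_def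
        O cQ_of_real bh_S_eq sin_of_real)
      (simp_all add: field_simps power2_eq_square)
  then show "?g $ 2 $ 2 = (bh_Omega \<alpha> (x $ 2) (x $ 3))\<^sup>2 * bh_Q a m q \<Lambda> \<alpha> (x $ 2) / bh_rho2 a (x $ 2) (x $ 3)"
    "?g $ 3 $ 3 = (bh_Omega \<alpha> (x $ 2) (x $ 3))\<^sup>2 * bh_P a m q \<Lambda> \<alpha> (x $ 3) / bh_rho2 a (x $ 2) (x $ 3)"
    "?g $ 2 $ 3 = 0" "?g $ 3 $ 2 = 0"
    by (simp_all only: of_real_eq_iff)
qed

subsection \<open>The limit at a root of Q\<close>

text \<open>Q is never the zero polynomial: its constant coefficient a^2 + q^2 vanishes only for a =
  q = 0, and then the coefficient of r^2 is 1.\<close>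

lemma finite_bh_Q_roots: "finite {r. bh_Q a m q \<Lambda> \<alpha> r = 0}"
proof -
  define c where "c = [:a\<^sup>2 + q\<^sup>2, - (2 * m), 1:] * [:1, 0, - (\<alpha>\<^sup>2):] - smult (1/3 * \<Lambda>) ([:a\<^sup>2, 0, 1:] * [:0, 0, 1:])"
  have "c \<noteq> 0"
  proof
    assume "c = 0"
    have "coeff c 0 = a\<^sup>2 + q\<^sup>2"
      by (simp add: c_def)
    then have "a = 0 \<and> q = 0"
      using \<open>c = 0\<close> by simp
    then have "coeff c 2 = 1"
      by (simp add: c_def numeral_2_eq_2)
    then show False using \<open>c = 0\<close> by simp
  qed
  moreover have "poly c r = bh_Q a m q \<Lambda> \<alpha> r" for r
    by (simp add: c_def bh_Q_def algebra_simps power2_eq_square)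
  ultimately show ?thesis
    using poly_roots_finite[of c] by simp
qed

lemma islimpt_bh_regular:
  assumes "0 \<le> p $ 3" "p $ 3 \<le> pi" "bh_Omega \<alpha> (p $ 2) (p $ 3) > 0"
    "bh_rho2 a (p $ 2) (p $ 3) \<noteq> 0" "bh_P a m q \<Lambda> \<alpha> (p $ 3) > 0"
  shows "p islimpt bh_regular a m q \<Lambda> \<alpha>"
proof -
  \<comment> \<open>The path changes r and \<theta> together: the motion in r leaves the horizon,
    and \<sigma> directs \<theta> into the open interval from 0 to pi, so that points on the axis
    are covered as well.\<close>
  define \<sigma> :: real where "\<sigma> = (if p $ 3 = 0 then 1 else - 1)"
  define \<gamma> :: "real \<Rightarrow> real^4" where "\<gamma> t = p + t *\<^sub>R (axis 2 1 + \<sigma> *\<^sub>R axis 3 1)" for t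
  let ?F = "at_right (0::real)"
  have \<gamma>2: "\<gamma> t $ 2 = p $ 2 + t" and \<gamma>3: "\<gamma> t $ 3 = p $ 3 + t * \<sigma>" for t
    by (simp_all add: \<gamma>_def axis_def)
  have lim: "(\<gamma> \<longlongrightarrow> p) ?F"
    unfolding \<gamma>_def[abs_def] by (rule tendsto_eq_intros | simp)+
  define W where "W = {x :: real^4. bh_Omega \<alpha> (x $ 2) (x $ 3) > 0 \<and> bh_rho2 a (x $ 2) (x $ 3) \<noteq> 0
      \<and> bh_P a m q \<Lambda> \<alpha> (x $ 3) > 0}"
  have "open W"
    unfolding W_def bh_Omega_def bh_rho2_def bh_P_def
    by (intro open_Collect_conj open_Collect_less open_Collect_neq continuous_intros)
  then have W: "eventually (\<lambda>t. \<gamma> t \<in> W) ?F"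
    using lim assms(3-5) by (auto simp: W_def dest!: topological_tendstoD)
  have small: "eventually (\<lambda>t. 0 < t \<and> t < 1) ?F"
    using eventually_at_right_real[of 0 1] by (auto elim: eventually_mono)
  then have pos: "eventually (\<lambda>t::real. 0 < t) ?F" by (rule eventually_mono) simp
  have axis: "eventually (\<lambda>t. 0 < \<gamma> t $ 3 \<and> \<gamma> t $ 3 < pi) ?F"
  proof (cases "p $ 3 = 0")
    case True
    show ?thesis
      by (rule eventually_mono[OF small]) (use True pi_gt3 in \<open>auto simp: \<gamma>3 \<sigma>_def\<close>)
  next
    case False
    then have "eventually (\<lambda>t. t < p $ 3) ?F"
      using assms(1) eventually_at_right_real[of 0 "p $ 3"] by (auto elim: eventually_mono)
    with pos show ?thesis
      by eventually_elim (use False assms(2) in \<open>auto simp: \<gamma>3 \<sigma>_def\<close>)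
  qed
  \<comment> \<open>The steps in r that lead to another root of Q. Zero is removed because
    \<open>p\<close> itself may lie on a horizon; the rest is finite, hence closed, and stays away
    from 0.\<close>
  define Z where "Z = (\<lambda>r. r - p $ 2) ` {r. bh_Q a m q \<Lambda> \<alpha> r = 0} - {0}"
  have "open (- Z)"
    unfolding Z_def by (intro open_Compl finite_imp_closed finite_Diff finite_imageI finite_bh_Q_roots)
  then have "eventually (\<lambda>t. t \<in> - Z) (nhds (0::real))"
    by (rule eventually_nhds_in_open) (simp add: Z_def)
  then have "eventually (\<lambda>t. t \<in> - Z) ?F"
    by (rule filter_leD[OF at_within_le_nhds])
  with pos have Q: "eventually (\<lambda>t. bh_Q a m q \<Lambda> \<alpha> (\<gamma> t $ 2) \<noteq> 0) ?F"
  proof eventually_elim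
    case (elim t)
    then show ?case
      by (auto simp: \<gamma>2 Z_def image_iff dest: spec[of _ "p $ 2 + t"])
  qed
  from W axis Q pos have in_D: "eventually (\<lambda>t. \<gamma> t \<in> bh_regular a m q \<Lambda> \<alpha> \<and> \<gamma> t \<noteq> p) ?F"
  proof eventually_elim
    case (elim t)
    have "\<gamma> t $ 2 \<noteq> p $ 2"
      using elim by (simp add: \<gamma>2)
    then show ?case
      using elim by (auto simp: W_def bh_regular_def)
  qed
  show ?thesis
    unfolding islimpt_def
  proof (intro allI impI)
    fix T assume "p \<in> T" "open T"
    then have "eventually (\<lambda>t. \<gamma> t \<in> T) ?F"
      using lim by (auto dest: topological_tendstoD)
    with in_D have "eventually (\<lambda>t. \<gamma> t \<in> bh_regular a m q \<Lambda> \<alpha> \<and> \<gamma> t \<in> T \<and> \<gamma> t \<noteq> p) ?F"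
      by eventually_elim simp
    then show "\<exists>y\<in>bh_regular a m q \<Lambda> \<alpha>. y \<in> T \<and> y \<noteq> p"
      using eventually_happens' trivial_limit_at_right_real by blast
  qed
qed

lemma pd_bh_invariant:
  assumes x: "x \<in> bh_regular a m q \<Lambda> \<alpha>"
    and eq: "\<And>y. y \<in> bh_regular a m q \<Lambda> \<alpha> \<Longrightarrow> of_real (I y) = F y" and pd: "bh_pd F F2 F3 x"
  shows "pd i I x = (if i = 2 then Re (F2 x) else if i = 3 then - (sin (x $ 3) * Re (F3 x)) else 0)"
proof -
  have "of_real (pd i I x) = (if i = 2 then F2 x else if i = 3 then - of_real (sin (x $ 3)) * F3 x else 0)"
    by (rule of_real_pd[OF open_bh_regular x eq pd[unfolded bh_pd_def, rule_format]])
  from arg_cong[where f = Re, OF this] show ?thesis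
    by (simp split: if_splits)
qed

text \<open>Lagrange's identity for the (r, \<theta>) block of the inverse metric, which is
  diagonal. Q is isolated as a factor so that the cofactor can be controlled at its roots.\<close>

lemma bh_gram_determinant:
  assumes x: "x \<in> bh_regular a m q \<Lambda> \<alpha>"
  defines "g \<equiv> bh_metric a m q \<Lambda> \<alpha>"
  assumes "\<And>i. pd i (I1 g) x = (if i = 2 then k2 else if i = 3 then k3 else 0)"
    "\<And>i. pd i (I2 g) x = (if i = 2 then l2 else if i = 3 then l3 else 0)"
  shows "I5 g x * I6 g x - (I7 g x)\<^sup>2 = bh_Q a m q \<Lambda> \<alpha> (x $ 2) *
     ((bh_Omega \<alpha> (x $ 2) (x $ 3)) ^ 4 * bh_P a m q \<Lambda> \<alpha> (x $ 3) / (bh_rho2 a (x $ 2) (x $ 3))\<^sup>2 * (k2 * l3 - k3 * l2)\<^sup>2)"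
proof -
  define G2 G3 where "G2 = (bh_Omega \<alpha> (x $ 2) (x $ 3))\<^sup>2 * bh_Q a m q \<Lambda> \<alpha> (x $ 2) / bh_rho2 a (x $ 2) (x $ 3)"
    and "G3 = (bh_Omega \<alpha> (x $ 2) (x $ 3))\<^sup>2 * bh_P a m q \<Lambda> \<alpha> (x $ 3) / bh_rho2 a (x $ 2) (x $ 3)"
  have "I5 g x = G2 * k2\<^sup>2 + G3 * k3\<^sup>2" "I6 g x = G2 * l2\<^sup>2 + G3 * l3\<^sup>2" "I7 g x = G2 * (k2 * l2) + G3 * (k3 * l3)"
    unfolding I5_def I6_def I7_def cov_inner_def k_cov_def l_cov_def G2_def G3_def
    by (simp_all add: sum_4 assms(3,4) bh_ginv[OF x, folded g_def] power2_eq_square)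
  then have "I5 g x * I6 g x - (I7 g x)\<^sup>2 = G2 * G3 * (k2 * l3 - k3 * l2)\<^sup>2"
    by (simp add: algebra_simps power2_eq_square)
  then show ?thesis
    unfolding G2_def G3_def by (simp add: power2_eq_square numeral_eq_Suc mult_ac)
qed

theorem corollary55:
  fixes a m q \<Lambda> \<alpha> :: real and p :: "real^4"
  assumes "0 \<le> p $ 3" and "p $ 3 \<le> pi"
    and "bh_Omega \<alpha> (p $ 2) (p $ 3) > 0"
    and "bh_rho2 a (p $ 2) (p $ 3) \<noteq> 0"
    and "bh_P a m q \<Lambda> \<alpha> (p $ 3) > 0"
    and "(ext_value (I1 (bh_metric a m q \<Lambda> \<alpha>)) (bh_regular a m q \<Lambda> \<alpha>) p)\<^sup>2
       + (ext_value (I2 (bh_metric a m q \<Lambda> \<alpha>)) (bh_regular a m q \<Lambda> \<alpha>) p)\<^sup>2 \<noteq> 0"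
    and "bh_Q a m q \<Lambda> \<alpha> (p $ 2) = 0"
  shows "extends_continuously (Q2 (bh_metric a m q \<Lambda> \<alpha>)) (bh_regular a m q \<Lambda> \<alpha>) p
       \<and> ext_value (Q2 (bh_metric a m q \<Lambda> \<alpha>)) (bh_regular a m q \<Lambda> \<alpha>) p = 0"
proof -
  let ?g = "bh_metric a m q \<Lambda> \<alpha>" and ?D = "bh_regular a m q \<Lambda> \<alpha>"
  let ?at = "at p within ?D"
  have limpt: "p islimpt ?D"
    by (rule islimpt_bh_regular) fact+
  \<comment> \<open>Limits at \<open>p\<close> within the regular domain are unique only for a
    nontrivial filter; every evaluation of \<open>ext_value\<close> below depends on this.\<close>
  then have nontriv: "?at \<noteq> bot"
    by (simp add: trivial_limit_within)
  have in_D: "eventually (\<lambda>x. x \<in> ?D) ?at"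
    by (simp add: eventually_at_filter)
  have p_dom: "p \<in> bh_dom a \<alpha>"
    using assms by (simp add: bh_dom_def)
  obtain F1 F2 where R: "F1 \<in> bh_ring a \<alpha>" "F2 \<in> bh_ring a \<alpha>"
    and I1: "\<And>x. x \<in> ?D \<Longrightarrow> of_real (I1 ?g x) = F1 x"
    and I2: "\<And>x. x \<in> ?D \<Longrightarrow> of_real (I2 ?g x) = F2 x"
    using bh_invariants by blast
  obtain F12 F13 F22 F23 where
    R': "F12 \<in> bh_ring a \<alpha>" "F13 \<in> bh_ring a \<alpha>" "F22 \<in> bh_ring a \<alpha>" "F23 \<in> bh_ring a \<alpha>"
    and pd1: "\<And>x. x \<in> bh_dom a \<alpha> \<Longrightarrow> bh_pd F1 F12 F13 x"
    and pd2: "\<And>x. x \<in> bh_dom a \<alpha> \<Longrightarrow> bh_pd F2 F22 F23 x"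
    using R[THEN bh_ring_differentiable] unfolding bh_differentiable_def by blast
  have lim: "((\<lambda>x. Re (F x)) \<longlongrightarrow> Re (F p)) ?at" if "F \<in> bh_ring a \<alpha>" for F
    using bh_ring_isCont[OF that p_dom] unfolding isCont_def
    by (rule tendsto_Re[OF tendsto_within_subset[OF _ subset_UNIV]])
  \<comment> \<open>The extended values of \<open>I1\<close> and \<open>I2\<close> are those of ring
    elements at \<open>p\<close>, so the hypothesis on them says that the denominator of
    \<open>Q2\<close> has a nonzero limit.\<close>
  have "ext_value (I1 ?g) ?D p = Re (F1 p)"
    unfolding ext_value_def
  proof (rule tendsto_Lim[OF nontriv])
    show "(I1 ?g \<longlongrightarrow> Re (F1 p)) ?at"
      by (rule Lim_transform_eventually[OF lim[OF R(1)] eventually_mono[OF in_D]]) (simp flip: I1)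
  qed
  moreover have "ext_value (I2 ?g) ?D p = Re (F2 p)"
    unfolding ext_value_def
  proof (rule tendsto_Lim[OF nontriv])
    show "(I2 ?g \<longlongrightarrow> Re (F2 p)) ?at"
      by (rule Lim_transform_eventually[OF lim[OF R(2)] eventually_mono[OF in_D]]) (simp flip: I2)
  qed
  ultimately have nz: "(Re (F1 p))\<^sup>2 + (Re (F2 p))\<^sup>2 \<noteq> 0"
    using assms(6) by simp
  define B where "B x = (bh_Omega \<alpha> (x $ 2) (x $ 3)) ^ 4 * bh_P a m q \<Lambda> \<alpha> (x $ 3) / (bh_rho2 a (x $ 2) (x $ 3))\<^sup>2 *
     (Re (F12 x) * - (sin (x $ 3) * Re (F23 x)) - - (sin (x $ 3) * Re (F13 x)) * Re (F22 x))\<^sup>2" for x :: "real^4"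
  \<comment> \<open>An explicit formula that agrees with \<open>Q2\<close> on the regular domain and
    also makes sense at \<open>p\<close>: \<open>B\<close> involves only ring elements, sin
    \<theta>, P, \<Omega> and the reciprocal of \<rho>^2, none of which is singular there.\<close>
  define \<Phi> where "\<Phi> x = 1/27 * (bh_Q a m q \<Lambda> \<alpha> (x $ 2) * B x / ((Re (F1 x))\<^sup>2 + (Re (F2 x))\<^sup>2) powr (5/2))" for x
  have Q2: "\<Phi> x = Q2 ?g x" if x: "x \<in> ?D" for x
  proof -
    have dom: "x \<in> bh_dom a \<alpha>"
      using x bh_regular_subset_dom by blast
    note pd_I1 = pd_bh_invariant[where I = "I1 ?g", OF x I1 pd1[OF dom]]
      and pd_I2 = pd_bh_invariant[where I = "I2 ?g", OF x I2 pd2[OF dom]]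
    have "I5 ?g x * I6 ?g x - (I7 ?g x)\<^sup>2 = bh_Q a m q \<Lambda> \<alpha> (x $ 2) * B x"
      unfolding B_def by (rule bh_gram_determinant[OF x pd_I1 pd_I2])
    then show ?thesis
      unfolding Q2_def \<Phi>_def by (simp flip: I1[OF x] I2[OF x])
  qed
  have comp: "((\<lambda>x. x $ i) \<longlongrightarrow> p $ i) ?at" for i :: 4
    by (intro tendsto_vec_nth tendsto_ident_at)
  have metric_lims: "((\<lambda>x. bh_Q a m q \<Lambda> \<alpha> (x $ 2)) \<longlongrightarrow> bh_Q a m q \<Lambda> \<alpha> (p $ 2)) ?at"
    "((\<lambda>x. bh_P a m q \<Lambda> \<alpha> (x $ 3)) \<longlongrightarrow> bh_P a m q \<Lambda> \<alpha> (p $ 3)) ?at"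
    "((\<lambda>x. bh_Omega \<alpha> (x $ 2) (x $ 3)) \<longlongrightarrow> bh_Omega \<alpha> (p $ 2) (p $ 3)) ?at"
    "((\<lambda>x. bh_rho2 a (x $ 2) (x $ 3)) \<longlongrightarrow> bh_rho2 a (p $ 2) (p $ 3)) ?at"
    "((\<lambda>x. sin (x $ 3)) \<longlongrightarrow> sin (p $ 3)) ?at"
    unfolding bh_Q_def bh_P_def bh_Omega_def bh_rho2_def by (intro tendsto_intros comp)+
  have "(bh_rho2 a (p $ 2) (p $ 3))\<^sup>2 \<noteq> 0"
    using assms(4) by simp
  then have B: "(B \<longlongrightarrow> B p) ?at"
    unfolding B_def[abs_def]
    by (intro tendsto_mult tendsto_divide tendsto_power tendsto_diff tendsto_minus metric_lims lim R')
  \<comment> \<open>The nonzero limit \<open>nz\<close> is needed twice: continuity of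
    \<open>powr\<close> requires a base away from zero, and the quotient requires a nonzero
    denominator.\<close>
  have "(\<Phi> \<longlongrightarrow> \<Phi> p) ?at"
    unfolding \<Phi>_def[abs_def]
    by (intro tendsto_mult tendsto_divide tendsto_powr tendsto_add tendsto_power tendsto_const
        metric_lims B lim R nz) (use nz in simp)
  moreover have "\<Phi> p = 0"
    using assms(7) by (simp add: \<Phi>_def)
  ultimately have "(\<Phi> \<longlongrightarrow> 0) ?at" by simp
  then have "(Q2 ?g \<longlongrightarrow> 0) ?at"
    by (rule Lim_transform_eventually[OF _ eventually_mono[OF in_D Q2]])
  then show ?thesis
    unfolding extends_continuously_def ext_value_def
    using limpt tendsto_Lim[OF nontriv] by blast
qed

end
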